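(* Consider the renewal system, the problem $$\text{Minimize } \limsup_{R\to\infty}\frac{\overline{y}_0[R]}{\overline{T}[R]}\quad\text{subject to}\quad \limsup_{R\to\infty}\frac{\overline{y}_l[R]}{\overline{T}[R]}\le c_l\ \ \forall l\in\{1,\ldots,L\},\qquad \pi[r]\in\mathcal{P}\ \ \forall r\in\{0,1,2,\ldots\},$$ and the drift-plus-penalty ratio algorithm, all described in the context. Assume the constraints of this problem are feasible, and let $ratio^{opt}$ be the infimum of the objective over all algorithms that satisfy the constraints. Fix constants $C\ge 0$, $V\ge 0$, and assume the drift-plus-penalty ratio algorithm is implemented using any $C$-additive approximation on every frame $r$. Assume the initial conditions satisfy $\mathbb{E}\{L(\boldsymbol{Z}[0])\}<\infty$. Then: (a) For all $l\in\{1,\ldots,L\}$: $$\limsup_{R\to\infty}\frac{\overline{y}_l[R]}{\overline{T}[R]}\le c_l,\qquad \limsup_{R\to\infty}\frac{\sum_{r=0}^{R-1}y_l[r]}{\sum_{r=0}^{R-1}T[r]}\le c_l\ \text{ with probability 1.}$$ (b) If $V>0$, then for all integers $R>0$: $$\frac{\overline{y}_0[R]}{\overline{T}[R]}\le ratio^{opt}+\frac{B/\overline{T}[R]+C}{V}+\frac{\mathbb{E}\{L(\boldsymbol{Z}[0])\}}{VR\,\overline{T}[R]},$$ and hence $$\limsup_{R\to\infty}\frac{\overline{y}_0[R]}{\overline{T}[R]}\le ratio^{opt}+\frac{B/T^{min}+C}{V}.$$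
   Context: Renewal system. Time is divided into successive frames $r=0,1,2,\ldots$. At the start of each frame $r$ a controller selects a policy $\pi[r]$ from an abstract policy space $\mathcal{P}$. This produces a positive frame duration $T[r]=\hat T(\pi[r])$ and penalties $y_l[r]=\hat y_l(\pi[r])$, $l\in\{0,1,\ldots,L\}$ ($L\ge 0$ an integer), where $\hat T(\cdot),\hat y_l(\cdot)$ are random functions of the policy: given $\pi[r]=\pi$, the vector $(T[r],y_0[r],\ldots,y_L[r])$ is conditionally independent of events in previous frames, and its conditional distribution depends only on $\pi$ (the same for all frames). An algorithm is any (possibly probabilistic, possibly history-dependent) rule for choosing $\pi[r]\in\mathcal{P}$ on every frame. The $c_l$, $l\in\{1,\ldots,L\}$, are given real constants. Boundedness assumptions. There are finite constants $y_0^{min},y_0^{max},T^{min},T^{max},\sigma_1$ such that for all $\pi[r]\in\mathcal{P}$: $y_0^{min}\le\mathbb{E}\{\hat y_0(\pi[r])|\pi[r]\}\le y_0^{max}$; $0<T^{min}\le\mathbb{E}\{\hat T(\pi[r])|\pi[r]\}\le T^{max}$; $\mathbb{E}\{\hat T(\pi[r])^2|\pi[r]\}\le\sigma_1$; and $\mathbb{E}\{\hat y_l(\pi[r])^2|\pi[r]\}\le\sigma_1$ for $l\in\{1,\ldots,L\}$. Averages. For integers $R>0$: $\overline{T}[R]=\frac1R\sum_{r=0}^{R-1}\mathbb{E}\{T[r]\}$, $\overline{y}_l[R]=\frac1R\sum_{r=0}^{R-1}\mathbb{E}\{y_l[r]\}$. Virtual queues. $\boldsymbol{Z}[r]=(Z_1[r],\ldots,Z_L[r])$,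 with finite nonnegative initial values and $Z_l[r+1]=\max[Z_l[r]+y_l[r]-c_lT[r],0]$. Define $L(\boldsymbol{Z}[r])=\frac12\sum_{l=1}^LZ_l[r]^2$. The constant $B$ satisfies, for all $r$ and all possible $\boldsymbol{Z}[r]$, $B\ge\frac12\sum_{l=1}^L\mathbb{E}\{(y_l[r]-c_lT[r])^2|\boldsymbol{Z}[r]\}$ (such $B$ exists by the boundedness assumptions). Drift-plus-penalty ratio algorithm, with parameter $V$. On every frame $r$, observe $\boldsymbol{Z}[r]$ and choose $\pi[r]\in\mathcal{P}$ to minimize $$\frac{\mathbb{E}\{V\hat y_0(\pi[r])+\sum_{l=1}^LZ_l[r]\hat y_l(\pi[r])\,|\,\boldsymbol{Z}[r]\}}{\mathbb{E}\{\hat T(\pi[r])\,|\,\boldsymbol{Z}[r]\}};$$ then observe the resulting $y_l[r],T[r]$ and update the virtual queues. The choice of $\pi[r]$ is a $C$-additive approximation if $$\frac{\mathbb{E}\{V\hat y_0(\pi[r])+\sum_{l=1}^LZ_l[r]\hat y_l(\pi[r])|\boldsymbol{Z}[r]\}}{\mathbb{E}\{\hat T(\pi[r])|\boldsymbol{Z}[r]\}}\le C+\inf_{\pi\in\mathcal{P}}\left[\frac{\mathbb{E}\{V\hat y_0(\pi)+\sum_{l=1}^LZ_l[r]\hat y_l(\pi)|\boldsymbol{Z}[r]\}}{\mathbb{E}\{\hat T(\pi)|\boldsymbol{Z}[r]\}}\right].$$ *)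

theory Defs
  imports "HOL-Probability.Probability"
begin

text \<open>
  A frame produces the vector \<open>(T, y\<^sub>0, \<dots>, y\<^sub>L)\<close>, encoded as a pair \<open>(T, y)\<close> with
  \<open>y\<close> an element of the product indexed by \<open>{0..L}\<close>.
\<close>

type_synonym outcome = "real \<times> (nat \<Rightarrow> real)"

definition outcome_space :: "nat \<Rightarrow> outcome measure" where
  "outcome_space L = borel \<Otimes>\<^sub>M (\<Pi>\<^sub>M l\<in>{0..L}. borel)"

text \<open>
  \<open>K p\<close> is the law of \<open>(T, y\<^sub>0, \<dots>, y\<^sub>L)\<close> under policy \<open>p\<close>. The two functions below are
  the expectations of the frame duration and of the penalties under the fixed policy \<open>p\<close>.
\<close>

definition mean_T :: "('p \<Rightarrow> outcome measure) \<Rightarrow> 'p \<Rightarrow> real" where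
  "mean_T K p = (\<integral>x. fst x \<partial>K p)"

definition mean_y :: "('p \<Rightarrow> outcome measure) \<Rightarrow> nat \<Rightarrow> 'p \<Rightarrow> real" where
  "mean_y K l p = (\<integral>x. snd x l \<partial>K p)"

text \<open>
  The policy space is \<open>space P\<close>. Its \<open>\<sigma>\<close>-algebra is arbitrary apart from making \<open>K\<close> a
  probability kernel; it is what allows policies to be selected at random.
\<close>

locale renewal_system =
  fixes P :: "'p measure" and K :: "'p \<Rightarrow> outcome measure" and L :: nat
    and y0min y0max Tmin Tmax \<sigma>1 :: real
  assumes kernel: "K \<in> P \<rightarrow>\<^sub>M prob_algebra (outcome_space L)"
    and T_pos: "\<And>p. p \<in> space P \<Longrightarrow> AE x in K p. 0 < fst x"
    and y0_integrable: "\<And>p. p \<in> space P \<Longrightarrow> integrable (K p) (\<lambda>x. snd x 0)"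
    and y0_bounds: "\<And>p. p \<in> space P \<Longrightarrow> y0min \<le> mean_y K 0 p \<and> mean_y K 0 p \<le> y0max"
    and T_integrable: "\<And>p. p \<in> space P \<Longrightarrow> integrable (K p) fst"
    and Tmin_pos: "0 < Tmin"
    and T_bounds: "\<And>p. p \<in> space P \<Longrightarrow> Tmin \<le> mean_T K p \<and> mean_T K p \<le> Tmax"
    and T_square_integrable: "\<And>p. p \<in> space P \<Longrightarrow> integrable (K p) (\<lambda>x. (fst x)\<^sup>2)"
    and T_square_bound: "\<And>p. p \<in> space P \<Longrightarrow> (\<integral>x. (fst x)\<^sup>2 \<partial>K p) \<le> \<sigma>1"
    and y_square_integrable:
      "\<And>p l. p \<in> space P \<Longrightarrow> l \<in> {1..L} \<Longrightarrow> integrable (K p) (\<lambda>x. (snd x l)\<^sup>2)"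
    and y_square_bound:
      "\<And>p l. p \<in> space P \<Longrightarrow> l \<in> {1..L} \<Longrightarrow> (\<integral>x. (snd x l)\<^sup>2 \<partial>K p) \<le> \<sigma>1"

text \<open>
  The renewal system run under an algorithm. \<open>F r\<close> is the information available once the
  policy \<open>pol r\<close> of frame \<open>r\<close> has been chosen and before its outcome is realised: it contains
  the earlier frames and all randomisation used so far, so policies may be randomised and
  history dependent in any way. Given \<open>F r\<close>, the outcome of frame \<open>r\<close> has law \<open>K (pol r)\<close>:
  it depends on \<open>F r\<close> only through the chosen policy.
  Integrability of \<open>y 0 r\<close> says that the expectation of \<open>y\<^sub>0[r]\<close> exists; for \<open>T\<close> and for the
  other penalties this follows from the second moment bounds.
\<close>

locale renewal_process = prob_space M + filtration "space M" F
  for M :: "'w measure" and F :: "nat \<Rightarrow> 'w measure" +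
  fixes P :: "'p measure" and K :: "'p \<Rightarrow> outcome measure" and L :: nat
    and pol :: "nat \<Rightarrow> 'w \<Rightarrow> 'p" and T :: "nat \<Rightarrow> 'w \<Rightarrow> real" and y :: "nat \<Rightarrow> nat \<Rightarrow> 'w \<Rightarrow> real"
  assumes subalg: "\<And>r. subalgebra M (F r)"
    and pol_measurable: "\<And>r. pol r \<in> F r \<rightarrow>\<^sub>M P"
    and T_measurable: "\<And>r. T r \<in> borel_measurable (F (Suc r))"
    and y_measurable: "\<And>l r. l \<in> {0..L} \<Longrightarrow> y l r \<in> borel_measurable (F (Suc r))"
    and outcome_law: "\<And>r A. A \<in> sets (outcome_space L) \<Longrightarrow>
      AE \<omega> in M. real_cond_exp M (F r) (\<lambda>\<omega>. indicator A (T r \<omega>, \<lambda>l\<in>{0..L}. y l r \<omega>)) \<omega>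
                 = measure (K (pol r \<omega>)) A"
    and y0_process_integrable: "\<And>r. integrable M (y 0 r)"

definition avg :: "'w measure \<Rightarrow> (nat \<Rightarrow> 'w \<Rightarrow> real) \<Rightarrow> nat \<Rightarrow> real" where
  "avg M X R = (1 / real R) * (\<Sum>r<R. \<integral>\<omega>. X r \<omega> \<partial>M)"

definition satisfies_constraints ::
  "'w measure \<Rightarrow> nat \<Rightarrow> (nat \<Rightarrow> real) \<Rightarrow> (nat \<Rightarrow> 'w \<Rightarrow> real) \<Rightarrow> (nat \<Rightarrow> nat \<Rightarrow> 'w \<Rightarrow> real) \<Rightarrow> bool" where
  "satisfies_constraints M L c T y \<longleftrightarrow>
     (\<forall>l\<in>{1..L}. limsup (\<lambda>R. ereal (avg M (y l) R / avg M T R)) \<le> ereal (c l))"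

text \<open>
  Objective values of all algorithms satisfying the constraints. The objective and the
  constraints depend only on the joint law of the trajectory
  \<open>(pol r, (T r, y\<^sub>0 r, \<dots>, y\<^sub>L r))\<close>, \<open>r = 0, 1, \<dots>\<close>. Taking trajectories as sample points
  therefore loses no algorithm: one living on any other probability space has the same
  averages as the coordinate process under its trajectory law.
\<close>

definition feasible_values ::
  "'p measure \<Rightarrow> ('p \<Rightarrow> outcome measure) \<Rightarrow> nat \<Rightarrow> (nat \<Rightarrow> real) \<Rightarrow> ereal set" where
  "feasible_values P K L c =
     {limsup (\<lambda>R. ereal (avg M (y 0) R / avg M T R)) |
        (M :: (nat \<Rightarrow> 'p \<times> outcome) measure) F pol T y.
        renewal_process M F P K L pol T y \<and> satisfies_constraints M L c T y}"

definition feasible ::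
  "'p measure \<Rightarrow> ('p \<Rightarrow> outcome measure) \<Rightarrow> nat \<Rightarrow> (nat \<Rightarrow> real) \<Rightarrow> bool" where
  "feasible P K L c \<longleftrightarrow> feasible_values P K L c \<noteq> {}"

definition ratio_opt ::
  "'p measure \<Rightarrow> ('p \<Rightarrow> outcome measure) \<Rightarrow> nat \<Rightarrow> (nat \<Rightarrow> real) \<Rightarrow> ereal" where
  "ratio_opt P K L c = Inf (feasible_values P K L c)"

definition virtual_queues ::
  "'w measure \<Rightarrow> (nat \<Rightarrow> 'w measure) \<Rightarrow> nat \<Rightarrow> (nat \<Rightarrow> real) \<Rightarrow> (nat \<Rightarrow> 'w \<Rightarrow> real) \<Rightarrow>
   (nat \<Rightarrow> nat \<Rightarrow> 'w \<Rightarrow> real) \<Rightarrow> (nat \<Rightarrow> nat \<Rightarrow> 'w \<Rightarrow> real) \<Rightarrow> bool" where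
  "virtual_queues M F L c T y Z \<longleftrightarrow>
     (\<forall>l\<in>{1..L}. Z l 0 \<in> borel_measurable (F 0) \<and>
        (\<forall>\<omega>\<in>space M. 0 \<le> Z l 0 \<omega> \<and>
           (\<forall>r. Z l (Suc r) \<omega> = max (Z l r \<omega> + y l r \<omega> - c l * T r \<omega>) 0)))"

definition lyapunov :: "nat \<Rightarrow> (nat \<Rightarrow> nat \<Rightarrow> 'w \<Rightarrow> real) \<Rightarrow> nat \<Rightarrow> 'w \<Rightarrow> real" where
  "lyapunov L Z r \<omega> = (1 / 2) * (\<Sum>l=1..L. (Z l r \<omega>)\<^sup>2)"

text \<open>The \<open>\<sigma>\<close>-algebra generated by \<open>(Z\<^sub>1[r], \<dots>, Z\<^sub>L[r])\<close>.\<close>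

definition sigma_Z :: "'w measure \<Rightarrow> nat \<Rightarrow> (nat \<Rightarrow> nat \<Rightarrow> 'w \<Rightarrow> real) \<Rightarrow> nat \<Rightarrow> 'w measure" where
  "sigma_Z M L Z r =
     vimage_algebra (space M) (\<lambda>\<omega>. \<lambda>l\<in>{1..L}. Z l r \<omega>) (\<Pi>\<^sub>M l\<in>{1..L}. borel)"

definition drift_bound ::
  "'w measure \<Rightarrow> nat \<Rightarrow> (nat \<Rightarrow> real) \<Rightarrow> (nat \<Rightarrow> 'w \<Rightarrow> real) \<Rightarrow> (nat \<Rightarrow> nat \<Rightarrow> 'w \<Rightarrow> real) \<Rightarrow>
   (nat \<Rightarrow> nat \<Rightarrow> 'w \<Rightarrow> real) \<Rightarrow> real \<Rightarrow> bool" where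
  "drift_bound M L c T y Z B \<longleftrightarrow>
     (\<forall>r. AE \<omega> in M.
        (1 / 2) * (\<Sum>l=1..L. real_cond_exp M (sigma_Z M L Z r) (\<lambda>\<omega>. (y l r \<omega> - c l * T r \<omega>)\<^sup>2) \<omega>) \<le> B)"

text \<open>
  In the infimum the policy \<open>p\<close> is fixed, so conditioning on the queues only freezes the
  weights and leaves the means of the outcome under \<open>p\<close>.
\<close>

definition additive_approx ::
  "'w measure \<Rightarrow> 'p measure \<Rightarrow> ('p \<Rightarrow> outcome measure) \<Rightarrow> nat \<Rightarrow> (nat \<Rightarrow> 'w \<Rightarrow> real) \<Rightarrow>
   (nat \<Rightarrow> nat \<Rightarrow> 'w \<Rightarrow> real) \<Rightarrow> (nat \<Rightarrow> nat \<Rightarrow> 'w \<Rightarrow> real) \<Rightarrow> real \<Rightarrow> real \<Rightarrow> bool" where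
  "additive_approx M P K L T y Z V C \<longleftrightarrow>
     (\<forall>r. AE \<omega> in M.
        real_cond_exp M (sigma_Z M L Z r) (\<lambda>\<omega>. V * y 0 r \<omega> + (\<Sum>l=1..L. Z l r \<omega> * y l r \<omega>)) \<omega>
          / real_cond_exp M (sigma_Z M L Z r) (T r) \<omega>
        \<le> C + (INF p\<in>space P. (V * mean_y K 0 p + (\<Sum>l=1..L. Z l r \<omega> * mean_y K l p)) / mean_T K p))"

end

theory Submission
  imports Defs "HOL-Library.Discrete_Functions" "HOL-Real_Asymp.Real_Asymp"
begin

text \<open>
  The Lyapunov function \<open>\<Lambda> = (1/2) \<Sum>Z\<^sub>l\<^sup>2\<close> of the virtual queues grows in one frame, in conditional mean, by at
  most \<open>B + \<Sum>Z\<^sub>l (y\<^sub>l - c\<^sub>l T)\<close>. Adding \<open>V y\<^sub>0\<close>, the quantity to control is \<open>V y\<^sub>0 + \<Sum>Z\<^sub>l y\<^sub>l\<close>, and the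
  algorithm keeps the ratio of its conditional mean to that of \<open>T\<close> within \<open>C\<close> of the infimum \<open>\<theta>(Z)\<close>
  of this ratio over all policies.

  The optimal value enters through \<open>\<theta>(z) \<le> V ratio_opt + \<Sum>z\<^sub>l c\<^sub>l\<close> for all weights \<open>z \<ge> 0\<close>. Every
  policy satisfies \<open>\<theta>(z) E T \<le> V E y\<^sub>0 + \<Sum>z\<^sub>l E y\<^sub>l\<close>. This inequality is linear in the means, so it
  passes to the policy actually drawn in a frame of an arbitrary algorithm and from there to time
  averages; dividing by the average of \<open>T\<close> and letting the horizon grow along a feasible algorithm
  gives the claim (\<open>ratio_opt_finite_and_bounds_penalty_ratio\<close>).

  Together these give \<open>E \<Lambda>[r+1] + V E y\<^sub>0[r] \<le> E \<Lambda>[r] + B + (C + V ratio_opt) E T[r]\<close>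
  (\<open>drift_plus_penalty\<close>). Telescoping and discarding \<open>E \<Lambda>[R] \<ge> 0\<close> yields the objective bound.
  Bounding \<open>E y\<^sub>0\<close> from below by \<open>y0min\<close> instead yields \<open>E Z\<^sub>l[R]\<^sup>2 = O(R)\<close>. Since
  \<open>\<Sum>\<^bsub>r<R\<^esub> (y\<^sub>l - c\<^sub>l T) \<le> Z\<^sub>l[R]\<close>, the mean constraint follows from \<open>E Z\<^sub>l[R] = O(\<surd>R)\<close>.

  For the almost sure constraint, a second moment of order \<open>R\<close> controls the process along \<open>R = k\<^sup>2\<close>,
  because \<open>\<Sum> k\<^sup>2 / k\<^sup>4\<close> converges. The sum of the absolute queue increments between consecutive squares
  has second moment of order \<open>k\<^sup>2\<close> as well, which fills the gaps and gives \<open>Z\<^sub>l[R] / R \<longlonglongrightarrow> 0\<close>. The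
  denominator is bounded below in the same way: \<open>\<Sum>(T - E[T | past])\<close> is a martingale with second moment
  at most \<open>R \<sigma>\<^sub>1\<close>, its drift per frame is at least \<open>Tmin\<close>, and the elapsed time is monotone.
\<close>

section \<open>Convergence along the squares\<close>

lemma power2_add_le: "(a + b)\<^sup>2 \<le> 2 * a\<^sup>2 + 2 * b\<^sup>2" for a b :: real
  using sum_squares_bound[of a b] by (simp add: power2_sum)

lemma power2_diff_le: "(a - b)\<^sup>2 \<le> 2 * a\<^sup>2 + 2 * b\<^sup>2" for a b :: real
  using power2_add_le[of a "- b"] by simp

lemma square_integrable_mult:
  fixes f g :: "'a \<Rightarrow> real"
  assumes [measurable]: "f \<in> borel_measurable M" "g \<in> borel_measurable M"
    and "integrable M (\<lambda>\<omega>. (f \<omega>)\<^sup>2)" "integrable M (\<lambda>\<omega>. (g \<omega>)\<^sup>2)"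
  shows "integrable M (\<lambda>\<omega>. f \<omega> * g \<omega>)"
proof (rule Bochner_Integration.integrable_bound)
  show "integrable M (\<lambda>\<omega>. (f \<omega>)\<^sup>2 + (g \<omega>)\<^sup>2)" using assms by simp
  show "AE \<omega> in M. norm (f \<omega> * g \<omega>) \<le> norm ((f \<omega>)\<^sup>2 + (g \<omega>)\<^sup>2)"
  proof (rule AE_I2)
    fix \<omega>
    have "0 \<le> \<bar>f \<omega>\<bar> * \<bar>g \<omega>\<bar>" by simp
    then have "\<bar>f \<omega>\<bar> * \<bar>g \<omega>\<bar> \<le> (f \<omega>)\<^sup>2 + (g \<omega>)\<^sup>2"
      using sum_squares_bound[of "\<bar>f \<omega>\<bar>" "\<bar>g \<omega>\<bar>"] by (simp only: power2_abs mult.assoc)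
    then show "norm (f \<omega> * g \<omega>) \<le> norm ((f \<omega>)\<^sup>2 + (g \<omega>)\<^sup>2)" by (simp add: abs_mult)
  qed
qed measurable

text \<open>
  The expectations of \<open>(X\<^sub>k / (k + 1)\<^sup>2)\<^sup>2\<close> are bounded by \<open>D / (k + 1)\<^sup>2\<close>, so the series of these squares
  has finite expectation, hence converges almost surely, and its terms vanish. Applied to the values
  of a process at time \<open>k\<^sup>2\<close>, the growth condition is a second moment linear in time.
\<close>
lemma (in prob_space) AE_tendsto_0_of_second_moment:
  fixes X :: "nat \<Rightarrow> 'a \<Rightarrow> real"
  assumes X [measurable]: "\<And>k. X k \<in> borel_measurable M" and I: "\<And>k. integrable M (\<lambda>\<omega>. (X k \<omega>)\<^sup>2)"
    and le: "\<And>k. (\<integral>\<omega>. (X k \<omega>)\<^sup>2 \<partial>M) \<le> D * (real k + 1)\<^sup>2"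
  shows "AE \<omega> in M. (\<lambda>k. X k \<omega> / (real k + 1)\<^sup>2) \<longlonglongrightarrow> 0"
proof -
  let ?f = "\<lambda>k \<omega>. (X k \<omega> / (real k + 1)\<^sup>2)\<^sup>2"
  have nn: "(\<integral>\<^sup>+\<omega>. ennreal (?f k \<omega>) \<partial>M) \<le> ennreal (\<bar>D\<bar> * (1 / real (Suc k) ^ 2))" for k
  proof -
    have i: "integrable M (?f k)" using I[of k] by (simp add: power_divide)
    have "(\<integral>\<^sup>+\<omega>. ennreal (?f k \<omega>) \<partial>M) = ennreal (\<integral>\<omega>. ?f k \<omega> \<partial>M)"
      by (rule nn_integral_eq_integral[OF i]) simp
    also have "(\<integral>\<omega>. ?f k \<omega> \<partial>M) = (\<integral>\<omega>. (X k \<omega>)\<^sup>2 \<partial>M) / ((real k + 1)\<^sup>2)\<^sup>2"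
      by (simp add: power_divide)
    also have "\<dots> \<le> (\<bar>D\<bar> * (real k + 1)\<^sup>2) / ((real k + 1)\<^sup>2)\<^sup>2"
      by (rule divide_right_mono[OF order.trans[OF le]]) (auto intro!: mult_right_mono)
    also have "\<dots> = \<bar>D\<bar> * (1 / real (Suc k) ^ 2)"
    proof -
      have cancel: "b * a / a\<^sup>2 = b * (1 / a)" if "a \<noteq> 0" for a b :: real
        using that by (simp add: power2_eq_square)
      show ?thesis by (subst cancel) (auto simp: add.commute)
    qed
    finally show ?thesis by (simp add: ennreal_leI)
  qed
  have sm: "summable (\<lambda>k. \<bar>D\<bar> * (1 / real (Suc k) ^ 2))"
    using inverse_power_summable[of 2, where 'a = real] summable_Suc_iff[of "\<lambda>k. 1 / real k ^ 2"]
    by (intro summable_mult) (simp add: inverse_eq_divide)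
  have "(\<integral>\<^sup>+\<omega>. (\<Sum>k. ennreal (?f k \<omega>)) \<partial>M) = (\<Sum>k. \<integral>\<^sup>+\<omega>. ennreal (?f k \<omega>) \<partial>M)"
    by (rule nn_integral_suminf) measurable
  also have "\<dots> \<le> (\<Sum>k. ennreal (\<bar>D\<bar> * (1 / real (Suc k) ^ 2)))"
    by (rule suminf_le[OF nn]) auto
  also have "\<dots> = ennreal (\<Sum>k. \<bar>D\<bar> * (1 / real (Suc k) ^ 2))"
    by (rule suminf_ennreal2[OF _ sm]) simp
  finally have "(\<integral>\<^sup>+\<omega>. (\<Sum>k. ennreal (?f k \<omega>)) \<partial>M) \<noteq> \<infinity>"
    by (auto simp: top_unique)
  then have "AE \<omega> in M. (\<Sum>k. ennreal (?f k \<omega>)) \<noteq> \<infinity>"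
    by (intro nn_integral_PInf_AE) measurable
  then show ?thesis
  proof eventually_elim
    case (elim \<omega>)
    then have "summable (\<lambda>k. ?f k \<omega>)" by (intro summable_suminf_not_top) auto
    then have "(\<lambda>k. ?f k \<omega>) \<longlonglongrightarrow> 0" by (rule summable_LIMSEQ_zero)
    then show ?case by simp
  qed
qed

text \<open>
  The passage from the squares to all times. With \<open>k\<^sup>2 \<le> R < (k + 1)\<^sup>2\<close>, both the numerator error and the
  denominator at time \<open>R\<close> are compared with quantities indexed by \<open>k\<close>; the error is negligible against
  \<open>(k + 1)\<^sup>2\<close>, while the denominator is at least of order \<open>t k\<^sup>2\<close>.
\<close>
lemma limsup_ratio_le_of_squares:
  fixes Y S W N :: "nat \<Rightarrow> real"
  assumes W: "(\<lambda>k. W k / (real k + 1)\<^sup>2) \<longlonglongrightarrow> 0" and N: "(\<lambda>k. N k / (real k + 1)\<^sup>2) \<longlonglongrightarrow> 0"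
    and t: "0 < t" and W0: "\<And>k. 0 \<le> W k"
    and Y: "\<And>R. Y R - c * S R \<le> W (floor_sqrt R)"
    and S: "\<And>R. real ((floor_sqrt R)\<^sup>2) * t + N (floor_sqrt R) \<le> S R"
  shows "limsup (\<lambda>R. ereal (Y R / S R)) \<le> ereal c"
proof -
  define w where "w k = W k / (real k + 1)\<^sup>2" for k
  define s where "s k = real (k\<^sup>2) / (real k + 1)\<^sup>2 * t + N k / (real k + 1)\<^sup>2" for k
  have q: "(\<lambda>k. real (k\<^sup>2) / (real k + 1)\<^sup>2) \<longlonglongrightarrow> 1"
  proof -
    have "(\<lambda>k. (real k / real (Suc k))\<^sup>2) \<longlonglongrightarrow> 1\<^sup>2" by (intro tendsto_power LIMSEQ_n_over_Suc_n)
    then show ?thesis by (simp add: power_divide add.commute)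
  qed
  have s: "s \<longlonglongrightarrow> t" unfolding s_def
    using tendsto_add[OF tendsto_mult_right[OF q] N, of t] by simp
  have wlim: "w \<longlonglongrightarrow> 0" unfolding w_def by (rule W)
  have fs: "filterlim floor_sqrt at_top sequentially"
    unfolding filterlim_at_top by (auto intro!: eventually_sequentiallyI[of "n\<^sup>2" for n] le_floor_sqrtI)
  have "(\<lambda>k. c + w k / s k) \<longlonglongrightarrow> c + 0 / t"
    by (intro tendsto_intros wlim s) (use t in simp)
  then have lim: "(\<lambda>R. c + w (floor_sqrt R) / s (floor_sqrt R)) \<longlonglongrightarrow> c"
    by (intro filterlim_compose[OF _ fs]) simp
  have "\<forall>\<^sub>F k in sequentially. 0 < s k" by (rule order_tendstoD(1)[OF s t])
  then have "\<forall>\<^sub>F R in sequentially. 0 < s (floor_sqrt R)"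
    using fs by (rule eventually_compose_filterlim)
  then have "\<forall>\<^sub>F R in sequentially. ereal (Y R / S R) \<le> ereal (c + w (floor_sqrt R) / s (floor_sqrt R))"
  proof eventually_elim
    case (elim R)
    let ?k = "floor_sqrt R" and ?m = "(real (floor_sqrt R) + 1)\<^sup>2"
    have m: "0 < ?m" by simp
    have sk: "s ?k * ?m = real (?k\<^sup>2) * t + N ?k" by (simp add: s_def add_divide_distrib[symmetric] field_simps)
    have p: "0 < s ?k * ?m" using elim m by (rule mult_pos_pos)
    have SR: "s ?k * ?m \<le> S R" using S[of R] sk by simp
    have SRp: "0 < S R" using p SR by linarith
    have "Y R / S R - c = (Y R - c * S R) / S R" using SRp by (simp add: field_simps)
    also have "\<dots> \<le> W ?k / S R" using SRp Y by (intro divide_right_mono) auto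
    also have "\<dots> \<le> W ?k / (s ?k * ?m)" by (rule divide_left_mono[OF SR W0]) (use p SRp in auto)
    also have "\<dots> = w ?k / s ?k" by (simp add: w_def)
    finally show ?case by simp
  qed
  then have "limsup (\<lambda>R. ereal (Y R / S R)) \<le> limsup (\<lambda>R. ereal (c + w (floor_sqrt R) / s (floor_sqrt R)))"
    by (rule Limsup_mono)
  also have "\<dots> = ereal c"
    by (rule lim_imp_Limsup) (use lim in auto)
  finally show ?thesis .
qed

section \<open>Means of a frame under a fixed policy\<close>

context renewal_system
begin

lemma fst_measurable_outcome [measurable]: "fst \<in> borel_measurable (outcome_space L)"
  unfolding outcome_space_def by measurable

lemma snd_measurable_outcome [measurable]:
  "l \<in> {0..L} \<Longrightarrow> (\<lambda>x. snd x l) \<in> borel_measurable (outcome_space L)"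
  unfolding outcome_space_def by measurable

lemma K_subprob: "K \<in> P \<rightarrow>\<^sub>M subprob_algebra (outcome_space L)"
  by (rule measurable_prob_algebraD[OF kernel])

lemma prob_space_K: "p \<in> space P \<Longrightarrow> prob_space (K p)"
  using measurable_space[OF kernel] by (simp add: space_prob_algebra)

lemma sets_K: "p \<in> space P \<Longrightarrow> sets (K p) = sets (outcome_space L)"
  using measurable_space[OF kernel] by (simp add: space_prob_algebra)

lemma measurable_K: "p \<in> space P \<Longrightarrow> f \<in> outcome_space L \<rightarrow>\<^sub>M N \<Longrightarrow> f \<in> K p \<rightarrow>\<^sub>M N"
  by (simp add: sets_K cong: measurable_cong_sets)

lemma mean_T_pos: "p \<in> space P \<Longrightarrow> 0 < mean_T K p"
  using T_bounds[of p] Tmin_pos by linarith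

lemma y_integrable:
  assumes p: "p \<in> space P" and l: "l \<in> {0..L}"
  shows "integrable (K p) (\<lambda>x. snd x l)"
proof (cases "l = 0")
  case False
  interpret Kp: prob_space "K p" by (rule prob_space_K[OF p])
  show ?thesis
    by (rule Kp.square_integrable_imp_integrable[OF measurable_K[OF p snd_measurable_outcome[OF l]]])
       (use False l in \<open>auto intro!: y_square_integrable[OF p]\<close>)
qed (use y0_integrable[OF p] in simp)

lemma mean_y_abs_le:
  assumes p: "p \<in> space P" and l: "l \<in> {1..L}"
  shows "\<bar>mean_y K l p\<bar> \<le> 1 + \<sigma>1"
proof -
  interpret Kp: prob_space "K p" by (rule prob_space_K[OF p])
  have i: "integrable (K p) (\<lambda>x. snd x l)" by (rule y_integrable[OF p]) (use l in simp)
  have sq: "\<bar>a\<bar> \<le> 1 + a\<^sup>2" for a :: real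
    using zero_le_power2[of "\<bar>a\<bar> - 1 / 2"] by (simp add: power2_diff power2_eq_square algebra_simps)
  have "\<bar>mean_y K l p\<bar> \<le> (\<integral>x. \<bar>snd x l\<bar> \<partial>K p)"
    unfolding mean_y_def by (rule integral_abs_bound)
  also have "\<dots> \<le> (\<integral>x. 1 + (snd x l)\<^sup>2 \<partial>K p)"
    by (rule integral_mono) (use i y_square_integrable[OF p l] sq in auto)
  also have "\<dots> = 1 + (\<integral>x. (snd x l)\<^sup>2 \<partial>K p)"
    using y_square_integrable[OF p l] by (simp add: Kp.prob_space)
  finally show ?thesis using y_square_bound[OF p l] by linarith
qed

text \<open>The quantity whose infimum over policies the algorithm approximates, for queue values \<open>z\<close>.\<close>
definition penalty_ratio :: "real \<Rightarrow> (nat \<Rightarrow> real) \<Rightarrow> 'p \<Rightarrow> real" where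
  "penalty_ratio V z p = (V * mean_y K 0 p + (\<Sum>l=1..L. z l * mean_y K l p)) / mean_T K p"

text \<open>
  On reals, an unbounded infimum would be an arbitrary value; the moment bounds make the infimum in
  the approximation condition a genuine lower bound of the ratios.
\<close>
lemma bdd_below_penalty_ratio:
  assumes V: "0 \<le> V" and z: "\<And>l. l \<in> {1..L} \<Longrightarrow> 0 \<le> z l"
  shows "bdd_below (penalty_ratio V z ` space P)"
proof (rule bdd_belowI2)
  fix p assume p: "p \<in> space P"
  define b where "b = V * \<bar>y0min\<bar> + (\<Sum>l=1..L. z l * (1 + \<sigma>1))"
  have s1: "l \<in> {1..L} \<Longrightarrow> 0 \<le> 1 + \<sigma>1" for l
    using mean_y_abs_le[OF p, of l] by linarith
  have b0: "0 \<le> b"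
    unfolding b_def
    by (rule add_nonneg_nonneg[OF mult_nonneg_nonneg[OF V] sum_nonneg])
       (auto intro!: mult_nonneg_nonneg z s1)
  have "- \<bar>y0min\<bar> \<le> mean_y K 0 p" using y0_bounds[OF p] by linarith
  then have 1: "- (V * \<bar>y0min\<bar>) \<le> V * mean_y K 0 p"
    using mult_left_mono[OF _ V, of "- \<bar>y0min\<bar>" "mean_y K 0 p"] by simp
  have 2: "- (\<Sum>l=1..L. z l * (1 + \<sigma>1)) \<le> (\<Sum>l=1..L. z l * mean_y K l p)"
    unfolding sum_negf[symmetric]
  proof (rule sum_mono)
    fix l assume l: "l \<in> {1..L}"
    show "- (z l * (1 + \<sigma>1)) \<le> z l * mean_y K l p"
      using mult_left_mono[OF _ z[OF l], of "- (1 + \<sigma>1)" "mean_y K l p"] mean_y_abs_le[OF p l]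
      by (simp only: mult_minus_right abs_le_iff) linarith
  qed
  have "- b / Tmin \<le> - b / mean_T K p"
    using b0 T_bounds[OF p] Tmin_pos by (simp add: frac_le)
  also have "\<dots> \<le> penalty_ratio V z p"
    unfolding penalty_ratio_def
    by (rule divide_right_mono) (use 1 2 mean_T_pos[OF p] in \<open>auto simp: b_def\<close>)
  finally show "- b / Tmin \<le> penalty_ratio V z p" .
qed

end

section \<open>The conditional law of a frame given the past\<close>

locale controlled_renewal =
  renewal_system P K L y0min y0max Tmin Tmax \<sigma>1 + renewal_process M F P K L pol T y
  for P :: "'p measure" and K :: "'p \<Rightarrow> outcome measure" and L :: nat
    and y0min y0max Tmin Tmax \<sigma>1 :: real
    and M :: "'w measure" and F :: "nat \<Rightarrow> 'w measure"
    and pol :: "nat \<Rightarrow> 'w \<Rightarrow> 'p" and T :: "nat \<Rightarrow> 'w \<Rightarrow> real" and y :: "nat \<Rightarrow> nat \<Rightarrow> 'w \<Rightarrow> real"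
begin

definition frame_outcome :: "nat \<Rightarrow> 'w \<Rightarrow> outcome" where
  "frame_outcome r \<omega> = (T r \<omega>, \<lambda>l\<in>{0..L}. y l r \<omega>)"

lemma F_le_M: "A \<in> sets (F r) \<Longrightarrow> A \<in> sets M"
  using subalg[of r] by (auto simp: subalgebra_def)

lemma F_measurable_M: "f \<in> F r \<rightarrow>\<^sub>M N \<Longrightarrow> f \<in> M \<rightarrow>\<^sub>M N"
  using measurable_from_subalg[OF subalg] by blast

lemma F_mono_measurable: "f \<in> F r \<rightarrow>\<^sub>M N \<Longrightarrow> r \<le> s \<Longrightarrow> f \<in> F s \<rightarrow>\<^sub>M N"
  by (rule measurable_from_subalg[rotated]) (auto simp: subalgebra_def space_F dest: sets_F_mono)

lemma T_measurable_M [measurable]: "T r \<in> borel_measurable M"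
  by (rule F_measurable_M[OF T_measurable])

lemma y_measurable_M [measurable]: "l \<in> {0..L} \<Longrightarrow> y l r \<in> borel_measurable M"
  by (rule F_measurable_M[OF y_measurable])

lemma pol_space: "\<omega> \<in> space M \<Longrightarrow> pol r \<omega> \<in> space P"
  using measurable_space[OF pol_measurable, of \<omega> r] by (simp add: space_F)

lemma frame_outcome_measurable [measurable]: "frame_outcome r \<in> M \<rightarrow>\<^sub>M outcome_space L"
  unfolding frame_outcome_def[abs_def] outcome_space_def by measurable

lemma K_pol_subprob: "(\<lambda>\<omega>. K (pol r \<omega>)) \<in> F r \<rightarrow>\<^sub>M subprob_algebra (outcome_space L)"
  by (rule measurable_compose[OF pol_measurable K_subprob])

lemma sigma_finite_subalgebraI: "subalgebra M G \<Longrightarrow> sigma_finite_subalgebra M G"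
  by (intro finite_measure_subalgebra_is_sigma_finite finite_measure_subalgebra.intro
       finite_measure_subalgebra_axioms.intro finite_measure_axioms)

text \<open>
  The assumption on conditional expectations of indicators says that, given the past, the outcome of
  a frame has law \<open>K (pol r)\<close>. Below it is integrated over past events, then extended from
  indicators to nonnegative functions and finally to integrable ones.
\<close>
lemma emeasure_frame_outcome:
  assumes A: "A \<in> sets (F r)" and B: "B \<in> sets (outcome_space L)"
  shows "emeasure M (A \<inter> (frame_outcome r -` B \<inter> space M)) = (\<integral>\<^sup>+\<omega>\<in>A. emeasure (K (pol r \<omega>)) B \<partial>M)"
proof -
  interpret S: sigma_finite_subalgebra M "F r" by (rule sigma_finite_subalgebraI[OF subalg])
  let ?I = "\<lambda>\<omega>. indicator B (frame_outcome r \<omega>) :: real"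
  have AM [measurable]: "A \<in> sets M" by (rule F_le_M[OF A])
  note B[measurable]
  have K1: "(\<lambda>\<omega>. measure (K (pol r \<omega>)) B) \<in> borel_measurable M"
    by (rule F_measurable_M[of _ r],
        rule measurable_compose[OF K_pol_subprob measurable_measure_subprob_algebra[OF B]])
  have bnd: "measure (K (pol r \<omega>)) B \<le> 1" if "\<omega> \<in> space M" for \<omega>
    using prob_space.prob_le_1[OF prob_space_K[OF pol_space[OF that]]] .
  have int: "integrable M (\<lambda>\<omega>. measure (K (pol r \<omega>)) B)"
    by (rule integrable_const_bound[of _ 1]) (use bnd K1 in auto)
  have "emeasure M (A \<inter> (frame_outcome r -` B \<inter> space M)) =
      ennreal (\<integral>\<omega>. indicator (A \<inter> (frame_outcome r -` B \<inter> space M)) \<omega> \<partial>M)"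
    by (subst Bochner_Integration.integral_indicator)
       (auto simp: emeasure_eq_measure intro!: arg_cong[where f="measure M"])
  also have "(\<integral>\<omega>. indicator (A \<inter> (frame_outcome r -` B \<inter> space M)) \<omega> \<partial>M) = (\<integral>\<omega>\<in>A. ?I \<omega> \<partial>M)"
    unfolding set_lebesgue_integral_def
    by (rule Bochner_Integration.integral_cong) (auto simp: indicator_def)
  also have "\<dots> = (\<integral>\<omega>\<in>A. real_cond_exp M (F r) ?I \<omega> \<partial>M)"
    by (rule S.real_cond_exp_intA[OF _ A], rule integrable_const_bound[of _ 1]) auto
  also have "\<dots> = (\<integral>\<omega>\<in>A. measure (K (pol r \<omega>)) B \<partial>M)"
    unfolding set_lebesgue_integral_def
    by (rule integral_cong_AE) (use outcome_law[OF B, of r] K1 in \<open>auto simp: frame_outcome_def\<close>)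
  also have "ennreal \<dots> = (\<integral>\<^sup>+\<omega>. ennreal (indicator A \<omega> * measure (K (pol r \<omega>)) B) \<partial>M)"
    unfolding set_lebesgue_integral_def real_scaleR_def
    by (subst nn_integral_eq_integral) (use integrable_real_mult_indicator[OF AM int] in \<open>auto simp: mult.commute\<close>)
  also have "\<dots> = (\<integral>\<^sup>+\<omega>\<in>A. emeasure (K (pol r \<omega>)) B \<partial>M)"
    by (rule nn_integral_cong)
       (auto simp: indicator_def finite_measure.emeasure_eq_measure[OF prob_space.finite_measure[OF prob_space_K[OF pol_space]]])
  finally show ?thesis .
qed

lemma nn_integral_frame_outcome:
  assumes A: "A \<in> sets (F r)" and f: "f \<in> borel_measurable (outcome_space L)"
  shows "(\<integral>\<^sup>+\<omega>\<in>A. f (frame_outcome r \<omega>) \<partial>M) = (\<integral>\<^sup>+\<omega>\<in>A. (\<integral>\<^sup>+x. f x \<partial>K (pol r \<omega>)) \<partial>M)"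
proof -
  let ?MA = "density M (indicator A)"
  have AM [measurable]: "A \<in> sets M" by (rule F_le_M[OF A])
  have Km: "(\<lambda>\<omega>. K (pol r \<omega>)) \<in> ?MA \<rightarrow>\<^sub>M subprob_algebra (outcome_space L)"
    using F_measurable_M[OF K_pol_subprob] by simp
  have Km': "(\<lambda>\<omega>. K (pol r \<omega>)) \<in> M \<rightarrow>\<^sub>M subprob_algebra (outcome_space L)"
    using F_measurable_M[OF K_pol_subprob] by simp
  have ne: "space ?MA \<noteq> {}" using not_empty by simp
  \<comment> \<open>Restricted to the past event \<open>A\<close>, the law of the outcome is the mixture of the kernel over \<open>A\<close>;
    equality of these two measures replaces an induction over \<open>f\<close>.\<close>
  have "distr ?MA (outcome_space L) (frame_outcome r) = ?MA \<bind> (\<lambda>\<omega>. K (pol r \<omega>))"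
  proof (rule measure_eqI)
    show "sets (distr ?MA (outcome_space L) (frame_outcome r)) = sets (?MA \<bind> (\<lambda>\<omega>. K (pol r \<omega>)))"
      using Km ne by (subst sets_bind[where N="outcome_space L"]) (auto simp: sets_K pol_space)
    fix B assume "B \<in> sets (distr ?MA (outcome_space L) (frame_outcome r))"
    then have B [measurable]: "B \<in> sets (outcome_space L)" by simp
    have "emeasure (distr ?MA (outcome_space L) (frame_outcome r)) B =
        emeasure M (A \<inter> (frame_outcome r -` B \<inter> space M))"
    proof -
      have "emeasure (distr ?MA (outcome_space L) (frame_outcome r)) B =
          (\<integral>\<^sup>+\<omega>. indicator A \<omega> * indicator (frame_outcome r -` B \<inter> space M) \<omega> \<partial>M)"
        by (simp add: emeasure_distr emeasure_density)
      also have "\<dots> = (\<integral>\<^sup>+\<omega>. indicator (A \<inter> (frame_outcome r -` B \<inter> space M)) \<omega> \<partial>M)"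
        by (simp only: indicator_inter_arith)
      also have "\<dots> = emeasure M (A \<inter> (frame_outcome r -` B \<inter> space M))"
        by (rule nn_integral_indicator) measurable
      finally show ?thesis .
    qed
    also have "\<dots> = (\<integral>\<^sup>+\<omega>. emeasure (K (pol r \<omega>)) B \<partial>?MA)"
      using measurable_compose[OF Km' measurable_emeasure_subprob_algebra[OF B]]
      by (simp add: emeasure_frame_outcome[OF A B] nn_integral_density mult.commute)
    also have "\<dots> = emeasure (?MA \<bind> (\<lambda>\<omega>. K (pol r \<omega>))) B"
      by (rule emeasure_bind[OF ne Km B, symmetric])
    finally show "emeasure (distr ?MA (outcome_space L) (frame_outcome r)) B =
        emeasure (?MA \<bind> (\<lambda>\<omega>. K (pol r \<omega>))) B" .
  qed
  then have "(\<integral>\<^sup>+x. f x \<partial>distr ?MA (outcome_space L) (frame_outcome r)) =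
      (\<integral>\<^sup>+\<omega>. (\<integral>\<^sup>+x. f x \<partial>K (pol r \<omega>)) \<partial>?MA)"
    using nn_integral_bind[OF f Km] by simp
  then show ?thesis
    using f measurable_compose[OF Km' nn_integral_measurable_subprob_algebra[OF f]]
    by (simp add: nn_integral_distr nn_integral_density mult.commute)
qed

lemma nonneg_kernel_integral:
  fixes f :: "outcome \<Rightarrow> real"
  assumes pos: "\<And>x. 0 \<le> f x"
    and intK: "\<And>p. p \<in> space P \<Longrightarrow> integrable (K p) f"
    and \<omega>: "\<omega> \<in> space M"
  shows "ennreal (\<integral>x. f x \<partial>K (pol r \<omega>)) = (\<integral>\<^sup>+x. ennreal (f x) \<partial>K (pol r \<omega>))"
  using nn_integral_eq_integral[OF intK[OF pol_space[OF \<omega>]]] pos by simp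

lemma kernel_integral_measurable:
  fixes f :: "outcome \<Rightarrow> real"
  assumes f: "f \<in> borel_measurable (outcome_space L)"
    and intK: "\<And>p. p \<in> space P \<Longrightarrow> integrable (K p) f"
  shows "(\<lambda>\<omega>. \<integral>x. f x \<partial>K (pol r \<omega>)) \<in> borel_measurable (F r)"
proof -
  have m: "(\<lambda>\<omega>. \<integral>\<^sup>+x. g x \<partial>K (pol r \<omega>)) \<in> borel_measurable (F r)"
    if "g \<in> borel_measurable (outcome_space L)" for g :: "outcome \<Rightarrow> ennreal"
    by (rule measurable_compose[OF K_pol_subprob nn_integral_measurable_subprob_algebra[OF that]])
  have "(\<lambda>\<omega>. enn2real (\<integral>\<^sup>+x. ennreal (f x) \<partial>K (pol r \<omega>)) - enn2real (\<integral>\<^sup>+x. ennreal (- f x) \<partial>K (pol r \<omega>)))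
      \<in> borel_measurable (F r)"
    using m[of "\<lambda>x. ennreal (f x)"] m[of "\<lambda>x. ennreal (- f x)"] f by measurable
  then show ?thesis
    by (subst measurable_cong[OF real_lebesgue_integral_def[OF intK]]) (auto simp: space_F pol_space)
qed

lemma integrable_frame_outcome:
  fixes f :: "outcome \<Rightarrow> real"
  assumes f: "f \<in> borel_measurable (outcome_space L)" and pos: "\<And>x. 0 \<le> f x"
    and intK: "\<And>p. p \<in> space P \<Longrightarrow> integrable (K p) f"
    and bnd: "\<And>p. p \<in> space P \<Longrightarrow> (\<integral>x. f x \<partial>K p) \<le> b"
  shows "integrable M (\<lambda>\<omega>. f (frame_outcome r \<omega>))"
proof (rule integrableI_nonneg)
  have "(\<integral>\<^sup>+\<omega>. f (frame_outcome r \<omega>) \<partial>M) = (\<integral>\<^sup>+\<omega>. ennreal (\<integral>x. f x \<partial>K (pol r \<omega>)) \<partial>M)"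
    using nn_integral_frame_outcome[of "space M" r "\<lambda>x. ennreal (f x)"] f sets.top[of "F r"]
    by (simp add: space_F nonneg_kernel_integral[OF pos intK] cong: nn_integral_cong)
  also have "\<dots> \<le> (\<integral>\<^sup>+\<omega>. ennreal b \<partial>M)"
    by (intro nn_integral_mono ennreal_leI bnd pol_space)
  also have "\<dots> < \<infinity>" by (simp add: emeasure_space_1)
  finally show "(\<integral>\<^sup>+\<omega>. f (frame_outcome r \<omega>) \<partial>M) < \<infinity>" .
qed (use f pos in auto)

lemma cond_exp_frame_outcome_nonneg:
  fixes f :: "outcome \<Rightarrow> real"
  assumes f: "f \<in> borel_measurable (outcome_space L)" and pos: "\<And>x. 0 \<le> f x"
    and intK: "\<And>p. p \<in> space P \<Longrightarrow> integrable (K p) f"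
    and int: "integrable M (\<lambda>\<omega>. f (frame_outcome r \<omega>))"
  shows "integrable M (\<lambda>\<omega>. \<integral>x. f x \<partial>K (pol r \<omega>)) \<and>
    (AE \<omega> in M. real_cond_exp M (F r) (\<lambda>\<omega>. f (frame_outcome r \<omega>)) \<omega> = (\<integral>x. f x \<partial>K (pol r \<omega>)))"
proof -
  interpret S: sigma_finite_subalgebra M "F r" by (rule sigma_finite_subalgebraI[OF subalg])
  let ?h = "\<lambda>\<omega>. \<integral>x. f x \<partial>K (pol r \<omega>)"
  have mF: "?h \<in> borel_measurable (F r)" by (rule kernel_integral_measurable[OF f intK])
  have mM [measurable]: "?h \<in> borel_measurable M" by (rule F_measurable_M[OF mF])
  have hpos: "0 \<le> ?h \<omega>" for \<omega> by (simp add: pos)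
  have eq: "(\<integral>\<^sup>+\<omega>. ennreal (indicator A \<omega> * f (frame_outcome r \<omega>)) \<partial>M) =
      (\<integral>\<^sup>+\<omega>. ennreal (indicator A \<omega> * ?h \<omega>) \<partial>M)" if A: "A \<in> sets (F r)" for A
  proof -
    have "(\<integral>\<^sup>+\<omega>. ennreal (indicator A \<omega> * f (frame_outcome r \<omega>)) \<partial>M) =
        (\<integral>\<^sup>+\<omega>\<in>A. ennreal (f (frame_outcome r \<omega>)) \<partial>M)"
      by (intro nn_integral_cong) (auto simp: indicator_def)
    also have "\<dots> = (\<integral>\<^sup>+\<omega>\<in>A. (\<integral>\<^sup>+x. ennreal (f x) \<partial>K (pol r \<omega>)) \<partial>M)"
      using f by (intro nn_integral_frame_outcome[OF A]) auto
    also have "\<dots> = (\<integral>\<^sup>+\<omega>. ennreal (indicator A \<omega> * ?h \<omega>) \<partial>M)"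
      by (intro nn_integral_cong)
         (auto simp: indicator_def nonneg_kernel_integral[OF pos intK])
    finally show ?thesis .
  qed
  have inth: "integrable M ?h"
  proof (rule integrableI_nonneg)
    have "(\<integral>\<^sup>+\<omega>. ennreal (?h \<omega>) \<partial>M) = (\<integral>\<^sup>+\<omega>. ennreal (f (frame_outcome r \<omega>)) \<partial>M)"
      using eq[of "space M"] sets.top[of "F r"] by (simp add: space_F cong: nn_integral_cong)
    also have "\<dots> < \<infinity>" using int pos by (simp add: integrable_iff_bounded)
    finally show "(\<integral>\<^sup>+\<omega>. ennreal (?h \<omega>) \<partial>M) < \<infinity>" .
  qed (use hpos in auto)
  have "AE \<omega> in M. real_cond_exp M (F r) (\<lambda>\<omega>. f (frame_outcome r \<omega>)) \<omega> = ?h \<omega>"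
  proof (rule S.real_cond_exp_charact[OF _ int inth mF])
    fix A assume A: "A \<in> sets (F r)"
    note [measurable] = F_le_M[OF A] f
    show "(\<integral>\<omega>\<in>A. f (frame_outcome r \<omega>) \<partial>M) = (\<integral>\<omega>\<in>A. ?h \<omega> \<partial>M)"
      unfolding set_lebesgue_integral_def real_scaleR_def
      by (subst (1 2) integral_eq_nn_integral) (auto simp: pos eq[OF A])
  qed
  with inth show ?thesis by blast
qed

text \<open>
  The general case follows by applying the nonnegative one to the positive and the negative part.
\<close>
lemma cond_exp_frame_outcome:
  fixes f :: "outcome \<Rightarrow> real"
  assumes f: "f \<in> borel_measurable (outcome_space L)"
    and intK: "\<And>p. p \<in> space P \<Longrightarrow> integrable (K p) f"
    and int: "integrable M (\<lambda>\<omega>. f (frame_outcome r \<omega>))"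
  shows "integrable M (\<lambda>\<omega>. \<integral>x. f x \<partial>K (pol r \<omega>))"
    "AE \<omega> in M. real_cond_exp M (F r) (\<lambda>\<omega>. f (frame_outcome r \<omega>)) \<omega> = (\<integral>x. f x \<partial>K (pol r \<omega>))"
    "(\<integral>\<omega>. f (frame_outcome r \<omega>) \<partial>M) = (\<integral>\<omega>. (\<integral>x. f x \<partial>K (pol r \<omega>)) \<partial>M)"
proof -
  interpret S: sigma_finite_subalgebra M "F r" by (rule sigma_finite_subalgebraI[OF subalg])
  let ?f1 = "\<lambda>x. max (f x) 0" and ?f2 = "\<lambda>x. max (- f x) 0"
  have split: "f = (\<lambda>x. ?f1 x - ?f2 x)" by (auto simp: fun_eq_iff)
  have i1: "integrable M (\<lambda>\<omega>. ?f1 (frame_outcome r \<omega>))" and i2: "integrable M (\<lambda>\<omega>. ?f2 (frame_outcome r \<omega>))"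
    using int by auto
  have k1: "p \<in> space P \<Longrightarrow> integrable (K p) ?f1" and k2: "p \<in> space P \<Longrightarrow> integrable (K p) ?f2" for p
    using intK[of p] by auto
  have m1: "?f1 \<in> borel_measurable (outcome_space L)" and m2: "?f2 \<in> borel_measurable (outcome_space L)"
    using f by auto
  note c1 = cond_exp_frame_outcome_nonneg[OF m1 _ k1 i1] and c2 = cond_exp_frame_outcome_nonneg[OF m2 _ k2 i2]
  have d: "(\<integral>x. f x \<partial>K (pol r \<omega>)) = (\<integral>x. ?f1 x \<partial>K (pol r \<omega>)) - (\<integral>x. ?f2 x \<partial>K (pol r \<omega>))"
    if "\<omega> \<in> space M" for \<omega>
    by (subst split, rule Bochner_Integration.integral_diff) (use that k1 k2 pol_space in auto)
  have "integrable M (\<lambda>\<omega>. (\<integral>x. ?f1 x \<partial>K (pol r \<omega>)) - (\<integral>x. ?f2 x \<partial>K (pol r \<omega>)))"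
    using c1 c2 by auto
  then show I: "integrable M (\<lambda>\<omega>. \<integral>x. f x \<partial>K (pol r \<omega>))"
    by (subst Bochner_Integration.integrable_cong[OF refl d]) 
  have "AE \<omega> in M. real_cond_exp M (F r) (\<lambda>\<omega>. ?f1 (frame_outcome r \<omega>) - ?f2 (frame_outcome r \<omega>)) \<omega>
      = real_cond_exp M (F r) (\<lambda>\<omega>. ?f1 (frame_outcome r \<omega>)) \<omega> - real_cond_exp M (F r) (\<lambda>\<omega>. ?f2 (frame_outcome r \<omega>)) \<omega>"
    by (rule S.real_cond_exp_diff[OF i1 i2])
  moreover have "(\<lambda>\<omega>. ?f1 (frame_outcome r \<omega>) - ?f2 (frame_outcome r \<omega>)) = (\<lambda>\<omega>. f (frame_outcome r \<omega>))"
    by (auto simp: fun_eq_iff)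
  ultimately show ce: "AE \<omega> in M. real_cond_exp M (F r) (\<lambda>\<omega>. f (frame_outcome r \<omega>)) \<omega> = (\<integral>x. f x \<partial>K (pol r \<omega>))"
    using c1 c2 d by auto
  have "(\<integral>\<omega>. f (frame_outcome r \<omega>) \<partial>M) = (\<integral>\<omega>. real_cond_exp M (F r) (\<lambda>\<omega>. f (frame_outcome r \<omega>)) \<omega> \<partial>M)"
    by (rule S.real_cond_exp_int(2)[OF int, symmetric])
  also have "\<dots> = (\<integral>\<omega>. (\<integral>x. f x \<partial>K (pol r \<omega>)) \<partial>M)"
    by (rule integral_cong_AE) (use ce I S.real_cond_exp_int(1)[OF int] in auto)
  finally show "(\<integral>\<omega>. f (frame_outcome r \<omega>) \<partial>M) = (\<integral>\<omega>. (\<integral>x. f x \<partial>K (pol r \<omega>)) \<partial>M)" .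
qed

lemma fst_frame_outcome [simp]: "fst (frame_outcome r \<omega>) = T r \<omega>"
  by (simp add: frame_outcome_def)

lemma snd_frame_outcome [simp]: "l \<in> {0..L} \<Longrightarrow> snd (frame_outcome r \<omega>) l = y l r \<omega>"
  by (simp add: frame_outcome_def)

lemma T_sq: "integrable M (\<lambda>\<omega>. (T r \<omega>)\<^sup>2)" "(\<integral>\<omega>. (T r \<omega>)\<^sup>2 \<partial>M) \<le> \<sigma>1"
proof -
  have I: "integrable M (\<lambda>\<omega>. (fst (frame_outcome r \<omega>))\<^sup>2)"
    by (rule integrable_frame_outcome[OF _ _ T_square_integrable T_square_bound]) auto
  then show "integrable M (\<lambda>\<omega>. (T r \<omega>)\<^sup>2)" by simp
  have "(\<integral>\<omega>. (fst (frame_outcome r \<omega>))\<^sup>2 \<partial>M) = (\<integral>\<omega>. (\<integral>x. (fst x)\<^sup>2 \<partial>K (pol r \<omega>)) \<partial>M)"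
    by (rule cond_exp_frame_outcome(3)[OF _ T_square_integrable I]) auto
  also have "\<dots> \<le> (\<integral>\<omega>. \<sigma>1 \<partial>M)"
    by (rule integral_mono[OF cond_exp_frame_outcome(1)[OF _ T_square_integrable I]])
       (auto intro: T_square_bound pol_space)
  finally show "(\<integral>\<omega>. (T r \<omega>)\<^sup>2 \<partial>M) \<le> \<sigma>1" by (simp add: prob_space)
qed

lemma y_sq:
  assumes l: "l \<in> {1..L}"
  shows "integrable M (\<lambda>\<omega>. (y l r \<omega>)\<^sup>2)" "(\<integral>\<omega>. (y l r \<omega>)\<^sup>2 \<partial>M) \<le> \<sigma>1"
proof -
  have l0: "l \<in> {0..L}" using l by simp
  note [measurable] = snd_measurable_outcome[OF l0]
  have I: "integrable M (\<lambda>\<omega>. (snd (frame_outcome r \<omega>) l)\<^sup>2)"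
    by (rule integrable_frame_outcome[OF _ _ y_square_integrable[OF _ l] y_square_bound[OF _ l]]) auto
  then show "integrable M (\<lambda>\<omega>. (y l r \<omega>)\<^sup>2)" using l0 by simp
  have "(\<integral>\<omega>. (snd (frame_outcome r \<omega>) l)\<^sup>2 \<partial>M) = (\<integral>\<omega>. (\<integral>x. (snd x l)\<^sup>2 \<partial>K (pol r \<omega>)) \<partial>M)"
    by (rule cond_exp_frame_outcome(3)[OF _ y_square_integrable[OF _ l] I]) auto
  also have "\<dots> \<le> (\<integral>\<omega>. \<sigma>1 \<partial>M)"
    by (rule integral_mono[OF cond_exp_frame_outcome(1)[OF _ y_square_integrable[OF _ l] I]])
       (auto intro: y_square_bound[OF _ l] pol_space)
  finally show "(\<integral>\<omega>. (y l r \<omega>)\<^sup>2 \<partial>M) \<le> \<sigma>1" using l0 by (simp add: prob_space)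
qed

lemma T_int [simp]: "integrable M (T r)"
  by (rule square_integrable_imp_integrable[OF _ T_sq(1)]) auto

lemma y_int: "l \<in> {0..L} \<Longrightarrow> integrable M (y l r)"
proof (cases "l = 0")
  case False
  assume "l \<in> {0..L}"
  with False have l: "l \<in> {1..L}" by auto
  show ?thesis
    by (rule square_integrable_imp_integrable[OF _ y_sq(1)[OF l]]) (use l in auto)
qed (use y0_process_integrable in auto)

lemma T_cond:
  shows T_cond_int: "integrable M (\<lambda>\<omega>. mean_T K (pol r \<omega>))"
    and T_cond_exp: "AE \<omega> in M. real_cond_exp M (F r) (T r) \<omega> = mean_T K (pol r \<omega>)"
    and T_cond_mean: "(\<integral>\<omega>. T r \<omega> \<partial>M) = (\<integral>\<omega>. mean_T K (pol r \<omega>) \<partial>M)"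
  using cond_exp_frame_outcome[OF fst_measurable_outcome T_integrable, of r] unfolding mean_T_def by auto

lemma mean_T_measurable: "(\<lambda>\<omega>. mean_T K (pol r \<omega>)) \<in> borel_measurable (F r)"
  unfolding mean_T_def by (rule kernel_integral_measurable[OF fst_measurable_outcome T_integrable])

lemma y_cond:
  assumes l: "l \<in> {0..L}"
  shows y_cond_int: "integrable M (\<lambda>\<omega>. mean_y K l (pol r \<omega>))"
    and y_cond_mean: "(\<integral>\<omega>. y l r \<omega> \<partial>M) = (\<integral>\<omega>. mean_y K l (pol r \<omega>) \<partial>M)"
  using cond_exp_frame_outcome[OF snd_measurable_outcome[OF l] y_integrable[OF _ l], of r] y_int[OF l] l
  unfolding mean_y_def by auto

lemma T_mean_bounds: "Tmin \<le> (\<integral>\<omega>. T r \<omega> \<partial>M)" "(\<integral>\<omega>. T r \<omega> \<partial>M) \<le> Tmax"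
proof -
  have "(\<integral>\<omega>. Tmin \<partial>M) \<le> (\<integral>\<omega>. mean_T K (pol r \<omega>) \<partial>M)"
    by (rule integral_mono) (use T_cond_int T_bounds pol_space in auto)
  then show "Tmin \<le> (\<integral>\<omega>. T r \<omega> \<partial>M)" by (simp add: T_cond_mean prob_space)
  have "(\<integral>\<omega>. mean_T K (pol r \<omega>) \<partial>M) \<le> (\<integral>\<omega>. Tmax \<partial>M)"
    by (rule integral_mono) (use T_cond_int T_bounds pol_space in auto)
  then show "(\<integral>\<omega>. T r \<omega> \<partial>M) \<le> Tmax" by (simp add: T_cond_mean prob_space)
qed

lemma y0_mean_bounds: "y0min \<le> (\<integral>\<omega>. y 0 r \<omega> \<partial>M)" "(\<integral>\<omega>. y 0 r \<omega> \<partial>M) \<le> y0max"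
proof -
  have i: "integrable M (\<lambda>\<omega>. mean_y K 0 (pol r \<omega>))" by (rule y_cond_int) simp
  have e: "(\<integral>\<omega>. y 0 r \<omega> \<partial>M) = (\<integral>\<omega>. mean_y K 0 (pol r \<omega>) \<partial>M)" by (rule y_cond_mean) simp
  have "(\<integral>\<omega>. y0min \<partial>M) \<le> (\<integral>\<omega>. mean_y K 0 (pol r \<omega>) \<partial>M)"
    by (rule integral_mono) (use i y0_bounds pol_space in auto)
  then show "y0min \<le> (\<integral>\<omega>. y 0 r \<omega> \<partial>M)" by (simp add: e prob_space)
  have "(\<integral>\<omega>. mean_y K 0 (pol r \<omega>) \<partial>M) \<le> (\<integral>\<omega>. y0max \<partial>M)"
    by (rule integral_mono) (use i y0_bounds pol_space in auto)
  then show "(\<integral>\<omega>. y 0 r \<omega> \<partial>M) \<le> y0max" by (simp add: e prob_space)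
qed

lemma T_pos_AE: "AE \<omega> in M. 0 < T r \<omega>"
proof -
  let ?B = "{x \<in> space (outcome_space L). fst x \<le> 0}"
  have B [measurable]: "?B \<in> sets (outcome_space L)" by measurable
  have "emeasure M (space M \<inter> (frame_outcome r -` ?B \<inter> space M))
      = (\<integral>\<^sup>+\<omega>\<in>space M. emeasure (K (pol r \<omega>)) ?B \<partial>M)"
    by (rule emeasure_frame_outcome[OF _ B]) (use sets.top[of "F r"] in \<open>simp add: space_F\<close>)
  also have "\<dots> = (\<integral>\<^sup>+\<omega>. 0 \<partial>M)"
  proof (rule nn_integral_cong)
    fix \<omega> assume \<omega>: "\<omega> \<in> space M"
    note p = pol_space[OF \<omega>, of r]
    have "AE x in K (pol r \<omega>). x \<notin> ?B" using T_pos[OF p] by eventually_elim auto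
    then have "emeasure (K (pol r \<omega>)) ?B = 0"
      using AE_iff_null_sets[of ?B "K (pol r \<omega>)"] B by (simp add: sets_K[OF p] null_sets_def)
    then show "emeasure (K (pol r \<omega>)) ?B * indicator (space M) \<omega> = 0" by simp
  qed
  finally have 0: "emeasure M (frame_outcome r -` ?B \<inter> space M) = 0"
    by simp
  show ?thesis
  proof (rule AE_I[OF _ 0])
    show "{x \<in> space M. \<not> 0 < T r x} \<subseteq> frame_outcome r -` ?B \<inter> space M"
      using measurable_space[OF frame_outcome_measurable] by auto
    show "frame_outcome r -` ?B \<inter> space M \<in> sets M" by measurable
  qed
qed

end

section \<open>Comparison with feasible algorithms\<close>

context controlled_renewal
begin

lemma avg_T_bounds: assumes "0 < R" shows "Tmin \<le> avg M T R" "0 < avg M T R"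
proof -
  have "real R * Tmin \<le> (\<Sum>r<R. \<integral>\<omega>. T r \<omega> \<partial>M)"
    using sum_bounded_below[of "{..<R}" Tmin "\<lambda>r. \<integral>\<omega>. T r \<omega> \<partial>M"] T_mean_bounds by simp
  then show 1: "Tmin \<le> avg M T R" using assms by (simp add: avg_def field_simps)
  show "0 < avg M T R" using 1 Tmin_pos by linarith
qed

lemma avg_y0_bounds: assumes "0 < R" shows "y0min \<le> avg M (y 0) R" "avg M (y 0) R \<le> y0max"
proof -
  have "real R * y0min \<le> (\<Sum>r<R. \<integral>\<omega>. y 0 r \<omega> \<partial>M)"
    using sum_bounded_below[of "{..<R}" y0min "\<lambda>r. \<integral>\<omega>. y 0 r \<omega> \<partial>M"] y0_mean_bounds by simp
  then show "y0min \<le> avg M (y 0) R" using assms by (simp add: avg_def field_simps)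
  have "(\<Sum>r<R. \<integral>\<omega>. y 0 r \<omega> \<partial>M) \<le> real R * y0max"
    using sum_bounded_above[of "{..<R}" "\<lambda>r. \<integral>\<omega>. y 0 r \<omega> \<partial>M" y0max] y0_mean_bounds by simp
  then show "avg M (y 0) R \<le> y0max" using assms by (simp add: avg_def field_simps)
qed

lemma abs_objective_le:
  assumes "0 < R"
  shows "\<bar>avg M (y 0) R / avg M T R\<bar> \<le> max \<bar>y0min\<bar> \<bar>y0max\<bar> / Tmin"
proof -
  have "\<bar>avg M (y 0) R\<bar> \<le> max \<bar>y0min\<bar> \<bar>y0max\<bar>" using avg_y0_bounds[OF assms] by linarith
  then show ?thesis
    using avg_T_bounds[OF assms] Tmin_pos by (auto simp: abs_divide intro!: frac_le)
qed

text \<open>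
  A lower bound \<open>\<theta>\<close> on the ratio for every policy is the linear inequality
  \<open>\<theta> E T \<le> V E y\<^sub>0 + \<Sum>z\<^sub>l E y\<^sub>l\<close>. It therefore survives averaging over a randomly chosen policy and over
  time, whatever the algorithm does.
\<close>
lemma avg_le_of_penalty_ratio:
  assumes \<theta>: "\<And>p. p \<in> space P \<Longrightarrow> \<theta> \<le> penalty_ratio V z p"
  shows "\<theta> * avg M T R \<le> V * avg M (y 0) R + (\<Sum>l=1..L. z l * avg M (y l) R)"
proof -
  have "\<theta> * (\<integral>\<omega>. T r \<omega> \<partial>M) \<le> V * (\<integral>\<omega>. y 0 r \<omega> \<partial>M) + (\<Sum>l=1..L. z l * (\<integral>\<omega>. y l r \<omega> \<partial>M))" for r
  proof -
    have i0: "integrable M (\<lambda>\<omega>. mean_y K 0 (pol r \<omega>))" by (rule y_cond_int) simp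
    have il: "integrable M (\<lambda>\<omega>. mean_y K l (pol r \<omega>))" if "l \<in> {1..L}" for l
      by (rule y_cond_int) (use that in simp)
    have I: "integrable M (\<lambda>\<omega>. V * mean_y K 0 (pol r \<omega>) + (\<Sum>l=1..L. z l * mean_y K l (pol r \<omega>)))"
      by (intro Bochner_Integration.integrable_add Bochner_Integration.integrable_sum integrable_mult_right i0 il)
    have "(\<integral>\<omega>. \<theta> * mean_T K (pol r \<omega>) \<partial>M)
        \<le> (\<integral>\<omega>. V * mean_y K 0 (pol r \<omega>) + (\<Sum>l=1..L. z l * mean_y K l (pol r \<omega>)) \<partial>M)"
    proof (rule integral_mono[OF _ I])
      fix \<omega> assume "\<omega> \<in> space M"
      from pol_space[OF this] have p: "pol r \<omega> \<in> space P" .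
      show "\<theta> * mean_T K (pol r \<omega>)
          \<le> V * mean_y K 0 (pol r \<omega>) + (\<Sum>l=1..L. z l * mean_y K l (pol r \<omega>))"
        using \<theta>[OF p] mean_T_pos[OF p] by (simp add: penalty_ratio_def pos_le_divide_eq)
    qed (use T_cond_int in simp)
    also have "\<dots> = V * (\<integral>\<omega>. mean_y K 0 (pol r \<omega>) \<partial>M) + (\<Sum>l=1..L. z l * (\<integral>\<omega>. mean_y K l (pol r \<omega>) \<partial>M))"
      using i0 il by (subst Bochner_Integration.integral_add) (auto simp: Bochner_Integration.integral_sum)
    also have "\<dots> = V * (\<integral>\<omega>. y 0 r \<omega> \<partial>M) + (\<Sum>l=1..L. z l * (\<integral>\<omega>. y l r \<omega> \<partial>M))"
      by (simp add: y_cond_mean)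
    finally show ?thesis by (simp add: T_cond_mean)
  qed
  then have "(\<Sum>r<R. \<theta> * (\<integral>\<omega>. T r \<omega> \<partial>M))
      \<le> (\<Sum>r<R. V * (\<integral>\<omega>. y 0 r \<omega> \<partial>M) + (\<Sum>l=1..L. z l * (\<integral>\<omega>. y l r \<omega> \<partial>M)))"
    by (rule sum_mono)
  also have "\<dots> = V * (\<Sum>r<R. \<integral>\<omega>. y 0 r \<omega> \<partial>M) + (\<Sum>l=1..L. z l * (\<Sum>r<R. \<integral>\<omega>. y l r \<omega> \<partial>M))"
    by (simp only: sum.distrib sum_distrib_left sum.swap[of "\<lambda>r l. z l * (\<integral>\<omega>. y l r \<omega> \<partial>M)" "{1..L}"])
  finally have "(\<theta> * (\<Sum>r<R. \<integral>\<omega>. T r \<omega> \<partial>M)) * (1 / real R)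
      \<le> (V * (\<Sum>r<R. \<integral>\<omega>. y 0 r \<omega> \<partial>M) + (\<Sum>l=1..L. z l * (\<Sum>r<R. \<integral>\<omega>. y l r \<omega> \<partial>M))) * (1 / real R)"
    by (intro mult_right_mono) (auto simp: sum_distrib_left)
  then show ?thesis
    by (simp add: avg_def add_divide_distrib
        sum_divide_distrib[of "\<lambda>l. z l * (\<Sum>r<R. \<integral>\<omega>. y l r \<omega> \<partial>M)" "{Suc 0..L}"])
qed

text \<open>
  Dividing the averaged inequality by the average of \<open>T\<close> leaves, for all large horizons, time-average
  ratios that exceed their limits superior by at most an arbitrarily small amount.
\<close>
lemma penalty_ratio_le_of_constraints:
  assumes con: "satisfies_constraints M L c T y"
    and \<theta>: "\<And>p. p \<in> space P \<Longrightarrow> \<theta> \<le> penalty_ratio V z p"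
    and z: "\<And>l. l \<in> {1..L} \<Longrightarrow> 0 \<le> z l" and V: "0 \<le> V"
    and v: "limsup (\<lambda>R. ereal (avg M (y 0) R / avg M T R)) = ereal v"
  shows "\<theta> \<le> V * v + (\<Sum>l=1..L. z l * c l)"
proof (rule field_le_epsilon)
  fix e :: real assume e: "0 < e"
  \<comment> \<open>The total weight, plus one to keep it positive, is the factor by which an error \<open>d\<close> in all
    ratios is amplified.\<close>
  define s where "s = V + (\<Sum>l=1..L. z l) + 1"
  have s: "0 < s" unfolding s_def using V sum_nonneg[of "{1..L}" z] z by fastforce
  define d where "d = e / s"
  have d: "0 < d" using e s by (simp add: d_def)
  have y0: "\<forall>\<^sub>F R in sequentially. ereal (avg M (y 0) R / avg M T R) < ereal (v + d)"
    by (rule Limsup_lessD) (use v d in simp)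
  have "\<forall>\<^sub>F R in sequentially. \<forall>l\<in>{1..L}. ereal (avg M (y l) R / avg M T R) < ereal (c l + d)"
  proof (rule eventually_ball_finite)
    show "\<forall>l\<in>{1..L}. \<forall>\<^sub>F R in sequentially. ereal (avg M (y l) R / avg M T R) < ereal (c l + d)"
    proof
      fix l assume l: "l \<in> {1..L}"
      have "limsup (\<lambda>R. ereal (avg M (y l) R / avg M T R)) \<le> ereal (c l)"
        using con l by (simp add: satisfies_constraints_def)
      also have "\<dots> < ereal (c l + d)" using d by simp
      finally show "\<forall>\<^sub>F R in sequentially. ereal (avg M (y l) R / avg M T R) < ereal (c l + d)"
        by (rule Limsup_lessD)
    qed
  qed simp
  with y0 eventually_gt_at_top[of 0]
  have "\<forall>\<^sub>F R in sequentially. \<theta> \<le> V * v + (\<Sum>l=1..L. z l * c l) + e"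
  proof eventually_elim
    case (elim R)
    let ?q = "\<lambda>l. avg M (y l) R / avg M T R"
    have pos: "0 < avg M T R" by (rule avg_T_bounds(2)[OF elim(2)])
    have "\<theta> \<le> (V * avg M (y 0) R + (\<Sum>l=1..L. z l * avg M (y l) R)) / avg M T R"
      using avg_le_of_penalty_ratio[OF \<theta>, of R] pos by (simp add: pos_le_divide_eq)
    also have "\<dots> = V * ?q 0 + (\<Sum>l=1..L. z l * ?q l)"
      by (simp add: add_divide_distrib sum_divide_distrib)
    also have "\<dots> \<le> V * (v + d) + (\<Sum>l=1..L. z l * (c l + d))"
      using elim V z by (intro add_mono mult_left_mono sum_mono) (auto intro: less_imp_le)
    also have "\<dots> = V * v + (\<Sum>l=1..L. z l * c l) + (s - 1) * d"
      by (simp add: s_def algebra_simps sum.distrib sum_distrib_left)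
    also have "(s - 1) * d \<le> e" using d s e by (simp add: d_def field_simps)
    finally show ?case by simp
  qed
  then show "\<theta> \<le> V * v + (\<Sum>l=1..L. z l * c l) + e" by (simp add: eventually_const)
qed

lemma limsup_objective_finite:
  "\<exists>v. limsup (\<lambda>R. ereal (avg M (y 0) R / avg M T R)) = ereal v \<and> - (max \<bar>y0min\<bar> \<bar>y0max\<bar> / Tmin) \<le> v"
proof -
  let ?b = "max \<bar>y0min\<bar> \<bar>y0max\<bar> / Tmin" and ?q = "\<lambda>R. ereal (avg M (y 0) R / avg M T R)"
  have q: "ereal (- ?b) \<le> ?q R \<and> ?q R \<le> ereal ?b" if "0 < R" for R
    using abs_objective_le[OF that] unfolding ereal_less_eq by (intro conjI; linarith)
  have "\<forall>\<^sub>F R in sequentially. ?q R \<le> ereal ?b"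
    using eventually_gt_at_top[of 0] by eventually_elim (use q in blast)
  then have "limsup ?q \<le> ereal ?b" by (rule Limsup_bounded)
  moreover have "\<forall>\<^sub>F R in sequentially. ereal (- ?b) \<le> ?q R"
    using eventually_gt_at_top[of 0] by eventually_elim (use q in blast)
  then have "ereal (- ?b) \<le> limsup ?q"
    by (rule le_Limsup[OF sequentially_bot])
  ultimately show ?thesis by (cases "limsup ?q") auto
qed

end

context renewal_system
begin

text \<open>
  Where the optimal value meets the algorithm: the comparison with each feasible algorithm holds with
  one and the same left-hand side, so it passes to the infimum of their objective values. The case
  \<open>V = 0\<close> has to be separated, since there the objective value drops out of the inequality and a single
  feasible algorithm already decides it.
\<close>
lemma ratio_opt_finite_and_bounds_penalty_ratio:
  assumes feas: "feasible P K L c"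
  obtains \<rho> where "ratio_opt P K L c = ereal \<rho>"
    and "\<And>V z. 0 \<le> V \<Longrightarrow> (\<And>l. l \<in> {1..L} \<Longrightarrow> 0 \<le> z l) \<Longrightarrow>
      (INF p\<in>space P. penalty_ratio V z p) \<le> V * \<rho> + (\<Sum>l=1..L. z l * c l)"
proof -
  let ?b = "max \<bar>y0min\<bar> \<bar>y0max\<bar> / Tmin" and ?S = "feasible_values P K L c"
  have *: "\<exists>v. x = ereal v \<and> - ?b \<le> v \<and>
      (\<forall>V z. 0 \<le> V \<longrightarrow> (\<forall>l\<in>{1..L}. 0 \<le> z l) \<longrightarrow>
        (INF p\<in>space P. penalty_ratio V z p) \<le> V * v + (\<Sum>l=1..L. z l * c l))"
    if x: "x \<in> ?S" for x
  proof -
    from x obtain M :: "(nat \<Rightarrow> 'p \<times> outcome) measure" and F pol T y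
      where x_def: "x = limsup (\<lambda>R. ereal (avg M (y 0) R / avg M T R))"
        and proc: "renewal_process M F P K L pol T y"
        and con: "satisfies_constraints M L c T y"
      unfolding feasible_values_def by blast
    interpret A: controlled_renewal P K L y0min y0max Tmin Tmax \<sigma>1 M F pol T y
      by (rule controlled_renewal.intro[OF renewal_system_axioms proc])
    obtain v where v: "limsup (\<lambda>R. ereal (avg M (y 0) R / avg M T R)) = ereal v" "- ?b \<le> v"
      using A.limsup_objective_finite by blast
    have "(INF p\<in>space P. penalty_ratio V z p) \<le> V * v + (\<Sum>l=1..L. z l * c l)"
      if "0 \<le> V" "\<forall>l\<in>{1..L}. 0 \<le> z l" for V z
      by (rule A.penalty_ratio_le_of_constraints[OF con _ _ that(1) v(1)])
         (use that bdd_below_penalty_ratio in \<open>auto intro!: cINF_lower\<close>)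
    with v x_def show ?thesis by blast
  qed
  have ne: "?S \<noteq> {}" using feas by (simp add: feasible_def)
  have lb: "ereal (- ?b) \<le> Inf ?S"
    by (rule Inf_greatest) (use * in fastforce)
  obtain x0 where x0: "x0 \<in> ?S" using ne by blast
  have "Inf ?S \<le> x0" by (rule Inf_lower[OF x0])
  moreover obtain v0 where "x0 = ereal v0" using *[OF x0] by blast
  ultimately obtain \<rho> where \<rho>: "Inf ?S = ereal \<rho>" using lb by (cases "Inf ?S") auto
  show thesis
  proof (rule that)
    show "ratio_opt P K L c = ereal \<rho>" by (simp add: ratio_opt_def \<rho>)
    fix V :: real and z :: "nat \<Rightarrow> real" assume V: "0 \<le> V" and z: "\<And>l. l \<in> {1..L} \<Longrightarrow> 0 \<le> z l"
    let ?\<theta> = "INF p\<in>space P. penalty_ratio V z p" and ?s = "\<Sum>l=1..L. z l * c l"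
    have le: "?\<theta> \<le> V * v + ?s" if "ereal v \<in> ?S" for v
      using *[OF that] V z by auto
    show "?\<theta> \<le> V * \<rho> + ?s"
    proof (cases "V = 0")
      case True
      then show ?thesis using le[of v0] x0 \<open>x0 = ereal v0\<close> by simp
    next
      case False
      then have Vp: "0 < V" using V by simp
      have "ereal ((?\<theta> - ?s) / V) \<le> Inf ?S"
      proof (rule Inf_greatest)
        fix x assume x: "x \<in> ?S"
        then obtain v where v: "x = ereal v" using * by blast
        with le x have "?\<theta> \<le> V * v + ?s" by blast
        then show "ereal ((?\<theta> - ?s) / V) \<le> x" using Vp by (simp add: v field_simps)
      qed
      then show ?thesis using Vp by (simp add: \<rho> field_simps)
    qed
  qed
qed

end
section \<open>Drift of the virtual queues\<close>

text \<open>
  Only the queue recursion and a square-integrable start are fixed here; the approximation property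
  and the constant \<open>B\<close> are stated where the drift estimate uses them.
\<close>
locale queued_renewal =
  controlled_renewal P K L y0min y0max Tmin Tmax \<sigma>1 M F pol T y
  for P :: "'p measure" and K :: "'p \<Rightarrow> outcome measure" and L :: nat
    and y0min y0max Tmin Tmax \<sigma>1 :: real
    and M :: "'w measure" and F :: "nat \<Rightarrow> 'w measure"
    and pol :: "nat \<Rightarrow> 'w \<Rightarrow> 'p" and T :: "nat \<Rightarrow> 'w \<Rightarrow> real" and y :: "nat \<Rightarrow> nat \<Rightarrow> 'w \<Rightarrow> real" +
  fixes c :: "nat \<Rightarrow> real" and Z :: "nat \<Rightarrow> nat \<Rightarrow> 'w \<Rightarrow> real"
  assumes queues: "virtual_queues M F L c T y Z"
    and init: "integrable M (lyapunov L Z 0)"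
begin

definition excess :: "nat \<Rightarrow> nat \<Rightarrow> 'w \<Rightarrow> real" where
  "excess l r \<omega> = y l r \<omega> - c l * T r \<omega>"

lemma Z_Suc: "l \<in> {1..L} \<Longrightarrow> \<omega> \<in> space M \<Longrightarrow> Z l (Suc r) \<omega> = max (Z l r \<omega> + excess l r \<omega>) 0"
  using queues by (simp add: virtual_queues_def excess_def add_diff_eq)

lemma Z_nonneg: "l \<in> {1..L} \<Longrightarrow> \<omega> \<in> space M \<Longrightarrow> 0 \<le> Z l r \<omega>"
  using queues by (cases r) (auto simp: virtual_queues_def)

lemma excess_measurable: "l \<in> {1..L} \<Longrightarrow> excess l r \<in> borel_measurable (F (Suc r))"
  unfolding excess_def[abs_def]
  by (intro borel_measurable_diff borel_measurable_times y_measurable T_measurable) auto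

lemma excess_measurable_M [measurable]: "l \<in> {1..L} \<Longrightarrow> excess l r \<in> borel_measurable M"
  by (rule F_measurable_M[OF excess_measurable])

lemma Z_measurable: "l \<in> {1..L} \<Longrightarrow> Z l r \<in> borel_measurable (F r)"
proof (induction r)
  case 0
  then show ?case using queues by (simp add: virtual_queues_def)
next
  case (Suc r)
  have "(\<lambda>\<omega>. max (Z l r \<omega> + excess l r \<omega>) 0) \<in> borel_measurable (F (Suc r))"
    using F_mono_measurable[OF Suc.IH[OF Suc.prems], of "Suc r"] excess_measurable[OF Suc.prems]
    by (intro borel_measurable_max borel_measurable_add) auto
  then show ?case
    by (subst measurable_cong[OF Z_Suc[OF Suc.prems]]) (auto simp: space_F)
qed

lemma Z_measurable_M [measurable]: "l \<in> {1..L} \<Longrightarrow> Z l r \<in> borel_measurable M"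
  by (rule F_measurable_M[OF Z_measurable])

lemma excess_sq:
  assumes l: "l \<in> {1..L}"
  shows "integrable M (\<lambda>\<omega>. (excess l r \<omega>)\<^sup>2)"
    and "(\<integral>\<omega>. (excess l r \<omega>)\<^sup>2 \<partial>M) \<le> 2 * \<sigma>1 + 2 * (c l)\<^sup>2 * \<sigma>1"
proof -
  have le: "(excess l r \<omega>)\<^sup>2 \<le> 2 * (y l r \<omega>)\<^sup>2 + 2 * (c l)\<^sup>2 * (T r \<omega>)\<^sup>2" for \<omega>
    using power2_diff_le[of "y l r \<omega>" "c l * T r \<omega>"] by (simp add: excess_def power_mult_distrib)
  have I: "integrable M (\<lambda>\<omega>. 2 * (y l r \<omega>)\<^sup>2 + 2 * (c l)\<^sup>2 * (T r \<omega>)\<^sup>2)"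
    using y_sq(1)[OF l] T_sq(1) by simp
  show J: "integrable M (\<lambda>\<omega>. (excess l r \<omega>)\<^sup>2)"
    by (rule Bochner_Integration.integrable_bound[OF I]) (use le l in \<open>auto intro!: AE_I2 order.trans[OF _ abs_ge_self]\<close>)
  have "(\<integral>\<omega>. (excess l r \<omega>)\<^sup>2 \<partial>M) \<le> (\<integral>\<omega>. 2 * (y l r \<omega>)\<^sup>2 + 2 * (c l)\<^sup>2 * (T r \<omega>)\<^sup>2 \<partial>M)"
    by (rule integral_mono[OF J I le])
  also have "\<dots> = 2 * (\<integral>\<omega>. (y l r \<omega>)\<^sup>2 \<partial>M) + 2 * (c l)\<^sup>2 * (\<integral>\<omega>. (T r \<omega>)\<^sup>2 \<partial>M)"
    using y_sq(1)[OF l] T_sq(1) by simp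
  also have "\<dots> \<le> 2 * \<sigma>1 + 2 * (c l)\<^sup>2 * \<sigma>1"
    using y_sq(2)[OF l] T_sq(2) by (intro add_mono mult_left_mono) auto
  finally show "(\<integral>\<omega>. (excess l r \<omega>)\<^sup>2 \<partial>M) \<le> 2 * \<sigma>1 + 2 * (c l)\<^sup>2 * \<sigma>1" .
qed

lemma excess_int: "l \<in> {1..L} \<Longrightarrow> integrable M (excess l r)"
  by (rule square_integrable_imp_integrable[OF _ excess_sq(1)]) auto

lemma Z_sq_int: "l \<in> {1..L} \<Longrightarrow> integrable M (\<lambda>\<omega>. (Z l r \<omega>)\<^sup>2)"
proof (induction r)
  case 0
  have "(Z l 0 \<omega>)\<^sup>2 \<le> 2 * lyapunov L Z 0 \<omega>" for \<omega>
    using member_le_sum[of l "{1..L}" "\<lambda>l. (Z l 0 \<omega>)\<^sup>2"] 0 by (simp add: lyapunov_def)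
  moreover have "integrable M (\<lambda>\<omega>. 2 * lyapunov L Z 0 \<omega>)" using init by simp
  ultimately show ?case
    by (rule_tac Bochner_Integration.integrable_bound[of M "\<lambda>\<omega>. 2 * lyapunov L Z 0 \<omega>"])
       (use 0 in \<open>auto intro!: AE_I2 order.trans[OF _ abs_ge_self]\<close>)
next
  case (Suc r)
  have I: "integrable M (\<lambda>\<omega>. 2 * (Z l r \<omega>)\<^sup>2 + 2 * (excess l r \<omega>)\<^sup>2)"
    using Suc excess_sq(1)[OF Suc.prems] by simp
  show ?case
  proof (rule Bochner_Integration.integrable_bound[OF I])
    show "AE \<omega> in M. norm ((Z l (Suc r) \<omega>)\<^sup>2) \<le> norm (2 * (Z l r \<omega>)\<^sup>2 + 2 * (excess l r \<omega>)\<^sup>2)"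
    proof (rule AE_I2)
      fix \<omega> assume "\<omega> \<in> space M"
      then have "(Z l (Suc r) \<omega>)\<^sup>2 \<le> (Z l r \<omega> + excess l r \<omega>)\<^sup>2"
        using Z_Suc[OF Suc.prems] by (simp add: max_def)
      then show "norm ((Z l (Suc r) \<omega>)\<^sup>2) \<le> norm (2 * (Z l r \<omega>)\<^sup>2 + 2 * (excess l r \<omega>)\<^sup>2)"
        using power2_add_le[of "Z l r \<omega>" "excess l r \<omega>"] by simp
    qed
  qed (use Suc.prems in measurable)
qed

lemma Z_int: "l \<in> {1..L} \<Longrightarrow> integrable M (Z l r)"
  by (rule square_integrable_imp_integrable[OF _ Z_sq_int]) auto

lemma lyapunov_int: "integrable M (lyapunov L Z r)"
  unfolding lyapunov_def[abs_def]
  by (intro integrable_mult_right Bochner_Integration.integrable_sum Z_sq_int)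

lemma Z_T_int: "l \<in> {1..L} \<Longrightarrow> integrable M (\<lambda>\<omega>. Z l r \<omega> * T r \<omega>)"
  by (rule square_integrable_mult[OF _ _ Z_sq_int T_sq(1)]) auto

lemma Z_y_int: "l \<in> {1..L} \<Longrightarrow> integrable M (\<lambda>\<omega>. Z l r \<omega> * y l r \<omega>)"
  by (rule square_integrable_mult[OF _ _ Z_sq_int y_sq(1)]) auto

lemma sigma_Z_subalgebra: "subalgebra M (sigma_Z M L Z r)"
  unfolding subalgebra_def sigma_Z_def
  by (intro conjI space_vimage_algebra sets_image_in_sets) measurable

lemma Z_measurable_sigma_Z:
  assumes "l \<in> {1..L}"
  shows "Z l r \<in> borel_measurable (sigma_Z M L Z r)"
proof -
  have 1: "(\<lambda>\<omega>. \<lambda>l\<in>{1..L}. Z l r \<omega>) \<in> sigma_Z M L Z r \<rightarrow>\<^sub>M (\<Pi>\<^sub>M l\<in>{1..L}. borel)"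
    unfolding sigma_Z_def by (rule measurable_vimage_algebra1) (auto simp: space_PiM)
  have "(\<lambda>\<omega>. (\<lambda>l\<in>{1..L}. Z l r \<omega>) l) \<in> borel_measurable (sigma_Z M L Z r)"
    by (rule measurable_compose[OF 1 measurable_component_singleton[OF assms]])
  then show ?thesis using assms by simp
qed

text \<open>Cutting off at \<open>0\<close> only decreases the square of a queue, so the square can be expanded without it.\<close>
lemma lyapunov_drift_pointwise:
  assumes "\<omega> \<in> space M"
  shows "lyapunov L Z (Suc r) \<omega> \<le> lyapunov L Z r \<omega> + (1 / 2) * (\<Sum>l=1..L. (excess l r \<omega>)\<^sup>2)
    + (\<Sum>l=1..L. Z l r \<omega> * excess l r \<omega>)"
proof -
  have "(\<Sum>l=1..L. (Z l (Suc r) \<omega>)\<^sup>2)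
      \<le> (\<Sum>l=1..L. (Z l r \<omega>)\<^sup>2 + (excess l r \<omega>)\<^sup>2 + 2 * (Z l r \<omega> * excess l r \<omega>))"
  proof (rule sum_mono)
    fix l assume l: "l \<in> {1..L}"
    have "(Z l (Suc r) \<omega>)\<^sup>2 \<le> (Z l r \<omega> + excess l r \<omega>)\<^sup>2"
      using Z_Suc[OF l assms] by (simp add: max_def)
    then show "(Z l (Suc r) \<omega>)\<^sup>2 \<le> (Z l r \<omega>)\<^sup>2 + (excess l r \<omega>)\<^sup>2 + 2 * (Z l r \<omega> * excess l r \<omega>)"
      by (simp add: power2_sum)
  qed
  also have "\<dots> = (\<Sum>l=1..L. (Z l r \<omega>)\<^sup>2) + (\<Sum>l=1..L. (excess l r \<omega>)\<^sup>2)
      + 2 * (\<Sum>l=1..L. Z l r \<omega> * excess l r \<omega>)"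
    by (simp only: sum.distrib sum_distrib_left)
  finally show ?thesis by (simp add: lyapunov_def)
qed

lemma lyapunov_drift:
  assumes B: "drift_bound M L c T y Z B"
  shows "(\<integral>\<omega>. lyapunov L Z (Suc r) \<omega> \<partial>M) \<le> (\<integral>\<omega>. lyapunov L Z r \<omega> \<partial>M) + B
    + (\<Sum>l=1..L. (\<integral>\<omega>. Z l r \<omega> * y l r \<omega> \<partial>M) - c l * (\<integral>\<omega>. Z l r \<omega> * T r \<omega> \<partial>M))"
proof -
  interpret S: sigma_finite_subalgebra M "sigma_Z M L Z r"
    by (rule sigma_finite_subalgebraI[OF sigma_Z_subalgebra])
  let ?e = "\<lambda>l \<omega>. (excess l r \<omega>)\<^sup>2"
  have Ze: "(\<lambda>\<omega>. Z l r \<omega> * excess l r \<omega>) = (\<lambda>\<omega>. Z l r \<omega> * y l r \<omega> - c l * (Z l r \<omega> * T r \<omega>))" for l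
    by (auto simp: fun_eq_iff excess_def algebra_simps)
  have ZeI: "integrable M (\<lambda>\<omega>. Z l r \<omega> * excess l r \<omega>)" if "l \<in> {1..L}" for l
    unfolding Ze using Z_T_int[OF that] Z_y_int[OF that] by simp
  have "(1 / 2) * (\<Sum>l=1..L. \<integral>\<omega>. ?e l \<omega> \<partial>M)
      = (\<integral>\<omega>. (1 / 2) * (\<Sum>l=1..L. real_cond_exp M (sigma_Z M L Z r) (?e l) \<omega>) \<partial>M)"
    using S.real_cond_exp_int[OF excess_sq(1)] by (simp add: Bochner_Integration.integral_sum)
  also have "\<dots> \<le> (\<integral>\<omega>. B \<partial>M)"
  proof (rule integral_mono_AE)
    show "integrable M (\<lambda>\<omega>. (1 / 2) * (\<Sum>l=1..L. real_cond_exp M (sigma_Z M L Z r) (?e l) \<omega>))"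
      by (intro integrable_mult_right Bochner_Integration.integrable_sum S.real_cond_exp_int(1) excess_sq(1))
    show "AE \<omega> in M. (1 / 2) * (\<Sum>l=1..L. real_cond_exp M (sigma_Z M L Z r) (?e l) \<omega>) \<le> B"
      using B unfolding drift_bound_def excess_def by blast
  qed simp
  finally have e: "(1 / 2) * (\<Sum>l=1..L. \<integral>\<omega>. ?e l \<omega> \<partial>M) \<le> B" by (simp add: prob_space)
  have I1: "integrable M (\<lambda>\<omega>. (1 / 2) * (\<Sum>l=1..L. ?e l \<omega>))"
    by (intro integrable_mult_right Bochner_Integration.integrable_sum excess_sq(1))
  have I2: "integrable M (\<lambda>\<omega>. \<Sum>l=1..L. Z l r \<omega> * excess l r \<omega>)"
    by (intro Bochner_Integration.integrable_sum ZeI)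
  have "(\<integral>\<omega>. lyapunov L Z (Suc r) \<omega> \<partial>M) \<le> (\<integral>\<omega>. lyapunov L Z r \<omega> + (1 / 2) * (\<Sum>l=1..L. ?e l \<omega>)
      + (\<Sum>l=1..L. Z l r \<omega> * excess l r \<omega>) \<partial>M)"
    by (rule integral_mono[OF lyapunov_int _ lyapunov_drift_pointwise])
       (intro Bochner_Integration.integrable_add lyapunov_int I1 I2)
  also have "\<dots> = (\<integral>\<omega>. lyapunov L Z r \<omega> \<partial>M) + (\<integral>\<omega>. (1 / 2) * (\<Sum>l=1..L. ?e l \<omega>) \<partial>M)
      + (\<integral>\<omega>. (\<Sum>l=1..L. Z l r \<omega> * excess l r \<omega>) \<partial>M)"
    by (simp only: Bochner_Integration.integral_add Bochner_Integration.integrable_add lyapunov_int I1 I2)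
  also have "(\<integral>\<omega>. (1 / 2) * (\<Sum>l=1..L. ?e l \<omega>) \<partial>M) = (1 / 2) * (\<Sum>l=1..L. \<integral>\<omega>. ?e l \<omega> \<partial>M)"
    by (simp add: Bochner_Integration.integral_sum excess_sq(1))
  also have "(\<integral>\<omega>. (\<Sum>l=1..L. Z l r \<omega> * excess l r \<omega>) \<partial>M)
      = (\<Sum>l=1..L. \<integral>\<omega>. Z l r \<omega> * excess l r \<omega> \<partial>M)"
    by (rule Bochner_Integration.integral_sum[OF ZeI])
  also have "\<dots> = (\<Sum>l=1..L. (\<integral>\<omega>. Z l r \<omega> * y l r \<omega> \<partial>M) - c l * (\<integral>\<omega>. Z l r \<omega> * T r \<omega> \<partial>M))"
    by (rule sum.cong[OF refl]) (simp add: Ze Z_y_int Z_T_int)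
  finally show ?thesis using e by linarith
qed

text \<open>
  The approximation property bounds \<open>E[V y\<^sub>0 + \<Sum>Z\<^sub>l y\<^sub>l | Z]\<close> by \<open>(C + V \<rho> + \<Sum>Z\<^sub>l c\<^sub>l) E[T | Z]\<close>. The queues
  are known given themselves, so the expectation of \<open>Z\<^sub>l E[T | Z]\<close> is that of \<open>Z\<^sub>l T\<close>, and the terms
  \<open>c\<^sub>l E (Z\<^sub>l T)\<close> cancel those in the drift. The number \<open>\<rho>\<close> stands for the optimal value, of which only
  its bound on the infimum of the ratios enters.
\<close>
lemma drift_plus_penalty:
  assumes B: "drift_bound M L c T y Z B"
    and approx: "additive_approx M P K L T y Z V C" and V: "0 \<le> V"
    and \<rho>: "\<And>z. \<forall>l\<in>{1..L}. 0 \<le> z l \<Longrightarrow>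
      (INF p\<in>space P. penalty_ratio V z p) \<le> V * \<rho> + (\<Sum>l=1..L. z l * c l)"
  shows "(\<integral>\<omega>. lyapunov L Z (Suc r) \<omega> \<partial>M) + V * (\<integral>\<omega>. y 0 r \<omega> \<partial>M)
    \<le> (\<integral>\<omega>. lyapunov L Z r \<omega> \<partial>M) + B + (C + V * \<rho>) * (\<integral>\<omega>. T r \<omega> \<partial>M)"
proof -
  let ?S = "sigma_Z M L Z r"
  interpret S: sigma_finite_subalgebra M ?S
    by (rule sigma_finite_subalgebraI[OF sigma_Z_subalgebra])
  define G where "G \<omega> = V * y 0 r \<omega> + (\<Sum>l=1..L. Z l r \<omega> * y l r \<omega>)" for \<omega>
  let ?t = "real_cond_exp M ?S (T r)"
  have y0I: "integrable M (y 0 r)" by (rule y_int) simp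
  have GI: "integrable M G"
    unfolding G_def[abs_def]
    by (intro Bochner_Integration.integrable_add Bochner_Integration.integrable_sum integrable_mult_right y0I Z_y_int)
  have Gint: "(\<integral>\<omega>. G \<omega> \<partial>M) = V * (\<integral>\<omega>. y 0 r \<omega> \<partial>M) + (\<Sum>l=1..L. \<integral>\<omega>. Z l r \<omega> * y l r \<omega> \<partial>M)"
    unfolding G_def using y0I Z_y_int
    by (subst Bochner_Integration.integral_add) (auto simp: Bochner_Integration.integral_sum)
  have tI: "integrable M ?t" and tint: "(\<integral>\<omega>. ?t \<omega> \<partial>M) = (\<integral>\<omega>. T r \<omega> \<partial>M)"
    using S.real_cond_exp_int[OF T_int] by auto
  have ZtI: "integrable M (\<lambda>\<omega>. Z l r \<omega> * ?t \<omega>)"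
    and Ztint: "(\<integral>\<omega>. Z l r \<omega> * ?t \<omega> \<partial>M) = (\<integral>\<omega>. Z l r \<omega> * T r \<omega> \<partial>M)" if "l \<in> {1..L}" for l
    using S.real_cond_exp_intg[OF Z_T_int[OF that] Z_measurable_sigma_Z[OF that]] by auto
  have tpos: "AE \<omega> in M. 0 < ?t \<omega>" by (rule S.real_cond_exp_gr_c[OF T_int T_pos_AE])
  have ap: "AE \<omega> in M. real_cond_exp M ?S G \<omega> / ?t \<omega> \<le> C + (INF p\<in>space P. penalty_ratio V (\<lambda>l. Z l r \<omega>) p)"
    using approx unfolding additive_approx_def G_def[abs_def] penalty_ratio_def by blast
  have key: "AE \<omega> in M. real_cond_exp M ?S G \<omega> \<le> (C + V * \<rho>) * ?t \<omega> + (\<Sum>l=1..L. c l * (Z l r \<omega> * ?t \<omega>))"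
    using tpos ap AE_space
  proof eventually_elim
    case (elim \<omega>)
    have "real_cond_exp M ?S G \<omega> / ?t \<omega> \<le> C + (V * \<rho> + (\<Sum>l=1..L. Z l r \<omega> * c l))"
      using elim(2) \<rho>[of "\<lambda>l. Z l r \<omega>"] Z_nonneg[OF _ elim(3)] by fastforce
    then have "real_cond_exp M ?S G \<omega> \<le> (C + (V * \<rho> + (\<Sum>l=1..L. Z l r \<omega> * c l))) * ?t \<omega>"
      using elim(1) by (simp add: pos_divide_le_eq)
    also have "\<dots> = (C + V * \<rho>) * ?t \<omega> + (\<Sum>l=1..L. Z l r \<omega> * c l) * ?t \<omega>"
      by (simp add: distrib_right)
    also have "(\<Sum>l=1..L. Z l r \<omega> * c l) * ?t \<omega> = (\<Sum>l=1..L. c l * (Z l r \<omega> * ?t \<omega>))"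
      unfolding sum_distrib_right by (simp add: mult_ac)
    finally show ?case .
  qed
  have "(\<integral>\<omega>. G \<omega> \<partial>M) = (\<integral>\<omega>. real_cond_exp M ?S G \<omega> \<partial>M)"
    by (rule S.real_cond_exp_int(2)[OF GI, symmetric])
  also have "\<dots> \<le> (\<integral>\<omega>. (C + V * \<rho>) * ?t \<omega> + (\<Sum>l=1..L. c l * (Z l r \<omega> * ?t \<omega>)) \<partial>M)"
    by (rule integral_mono_AE[OF S.real_cond_exp_int(1)[OF GI] _ key])
       (intro Bochner_Integration.integrable_add Bochner_Integration.integrable_sum integrable_mult_right tI ZtI)
  also have "\<dots> = (C + V * \<rho>) * (\<integral>\<omega>. T r \<omega> \<partial>M) + (\<Sum>l=1..L. c l * (\<integral>\<omega>. Z l r \<omega> * T r \<omega> \<partial>M))"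
    using tI ZtI by (subst Bochner_Integration.integral_add) (auto simp: Bochner_Integration.integral_sum tint Ztint)
  finally have "V * (\<integral>\<omega>. y 0 r \<omega> \<partial>M) + (\<Sum>l=1..L. \<integral>\<omega>. Z l r \<omega> * y l r \<omega> \<partial>M)
      \<le> (C + V * \<rho>) * (\<integral>\<omega>. T r \<omega> \<partial>M) + (\<Sum>l=1..L. c l * (\<integral>\<omega>. Z l r \<omega> * T r \<omega> \<partial>M))"
    by (simp add: Gint)
  with lyapunov_drift[OF B, of r] show ?thesis by (simp add: sum_subtractf)
qed

lemma drift_plus_penalty_telescoped:
  assumes B: "drift_bound M L c T y Z B"
    and approx: "additive_approx M P K L T y Z V C" and V: "0 \<le> V"
    and \<rho>: "\<And>z. \<forall>l\<in>{1..L}. 0 \<le> z l \<Longrightarrow>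
      (INF p\<in>space P. penalty_ratio V z p) \<le> V * \<rho> + (\<Sum>l=1..L. z l * c l)"
  shows "(\<integral>\<omega>. lyapunov L Z R \<omega> \<partial>M) + V * (\<Sum>r<R. \<integral>\<omega>. y 0 r \<omega> \<partial>M)
    \<le> (\<integral>\<omega>. lyapunov L Z 0 \<omega> \<partial>M) + real R * B + (C + V * \<rho>) * (\<Sum>r<R. \<integral>\<omega>. T r \<omega> \<partial>M)"
proof (induction R)
  case (Suc R)
  then show ?case
    using drift_plus_penalty[OF B approx V \<rho>, of R] by (simp add: distrib_left distrib_right)
qed simp

text \<open>
  Since the penalty \<open>y\<^sub>0\<close> has mean at least \<open>y0min\<close>, the drift per frame is bounded by a constant.
\<close>
lemma lyapunov_linear_growth:
  assumes B: "drift_bound M L c T y Z B"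
    and approx: "additive_approx M P K L T y Z V C" and V: "0 \<le> V"
    and \<rho>: "\<And>z. \<forall>l\<in>{1..L}. 0 \<le> z l \<Longrightarrow>
      (INF p\<in>space P. penalty_ratio V z p) \<le> V * \<rho> + (\<Sum>l=1..L. z l * c l)"
  shows "\<exists>D\<ge>0. \<forall>R. (\<integral>\<omega>. lyapunov L Z R \<omega> \<partial>M) \<le> D * (real R + 1)"
proof -
  define E0 where "E0 = (\<integral>\<omega>. lyapunov L Z 0 \<omega> \<partial>M)"
  define D where "D = \<bar>B\<bar> + \<bar>C + V * \<rho>\<bar> * Tmax + V * \<bar>y0min\<bar>"
  have E0: "0 \<le> E0"
    unfolding E0_def lyapunov_def by (auto intro!: integral_nonneg_AE AE_I2 sum_nonneg)
  have Tmax: "0 \<le> Tmax" using T_mean_bounds[of 0] Tmin_pos by linarith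
  have D: "0 \<le> D" unfolding D_def using V Tmax by simp
  have "(\<integral>\<omega>. lyapunov L Z R \<omega> \<partial>M) \<le> E0 + real R * D" for R
  proof (induction R)
    case (Suc R)
    have "- (V * (\<integral>\<omega>. y 0 R \<omega> \<partial>M)) \<le> V * \<bar>y0min\<bar>"
      using mult_left_mono[OF _ V, of "- (\<integral>\<omega>. y 0 R \<omega> \<partial>M)" "\<bar>y0min\<bar>"] y0_mean_bounds(1)[of R] by simp
    moreover have "(C + V * \<rho>) * (\<integral>\<omega>. T R \<omega> \<partial>M) \<le> \<bar>C + V * \<rho>\<bar> * Tmax"
      by (rule mult_mono) (use T_mean_bounds[of R] Tmin_pos in auto)
    ultimately have "(\<integral>\<omega>. lyapunov L Z (Suc R) \<omega> \<partial>M) \<le> (\<integral>\<omega>. lyapunov L Z R \<omega> \<partial>M) + D"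
      using drift_plus_penalty[OF B approx V \<rho>, of R] unfolding D_def by linarith
    with Suc show ?case by (simp add: distrib_right)
  qed (simp add: E0_def)
  moreover have "E0 + real R * D \<le> (E0 + D) * (real R + 1)" for R
    using E0 D by (simp add: algebra_simps)
  ultimately show ?thesis
    using E0 D by (intro exI[of _ "E0 + D"]) (auto intro: order.trans)
qed

end

section \<open>Elapsed time grows linearly almost surely\<close>

context controlled_renewal
begin

text \<open>The martingale part of the elapsed time.\<close>
definition time_noise :: "nat \<Rightarrow> 'w \<Rightarrow> real" where
  "time_noise R \<omega> = (\<Sum>r<R. T r \<omega> - mean_T K (pol r \<omega>))"

lemma mean_T_measurable_M [measurable]: "(\<lambda>\<omega>. mean_T K (pol r \<omega>)) \<in> borel_measurable M"
  by (rule F_measurable_M[OF mean_T_measurable])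

lemma time_noise_measurable: "time_noise R \<in> borel_measurable (F R)"
  unfolding time_noise_def[abs_def]
proof (intro borel_measurable_sum borel_measurable_diff)
  fix r assume "r \<in> {..<R}"
  then show "T r \<in> borel_measurable (F R)" and "(\<lambda>\<omega>. mean_T K (pol r \<omega>)) \<in> borel_measurable (F R)"
    using F_mono_measurable[OF T_measurable] F_mono_measurable[OF mean_T_measurable] by auto
qed

lemma time_noise_measurable_M [measurable]: "time_noise R \<in> borel_measurable M"
  by (rule F_measurable_M[OF time_noise_measurable])

lemma mean_T_sq_int: "integrable M (\<lambda>\<omega>. (mean_T K (pol r \<omega>))\<^sup>2)"
proof (rule integrable_const_bound[of _ "Tmax\<^sup>2"])
  show "AE \<omega> in M. norm ((mean_T K (pol r \<omega>))\<^sup>2) \<le> Tmax\<^sup>2"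
  proof (rule AE_I2)
    fix \<omega> assume "\<omega> \<in> space M"
    from pol_space[OF this] have p: "pol r \<omega> \<in> space P" .
    have "0 \<le> mean_T K (pol r \<omega>)" using mean_T_pos[OF p] by linarith
    then show "norm ((mean_T K (pol r \<omega>))\<^sup>2) \<le> Tmax\<^sup>2"
      using T_bounds[OF p] by (simp add: power_mono)
  qed
qed measurable

text \<open>
  Martingale increments are orthogonal: pairing \<open>T\<close> with anything known before the frame is the same as
  pairing its conditional mean. So second moments of the increments add up, and each is at most
  \<open>E T\<^sup>2\<close>.
\<close>
lemma time_noise_second_moment:
  "integrable M (\<lambda>\<omega>. (time_noise R \<omega>)\<^sup>2) \<and> (\<integral>\<omega>. (time_noise R \<omega>)\<^sup>2 \<partial>M) \<le> real R * \<sigma>1"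
proof (induction R)
  case 0
  show ?case by (simp add: time_noise_def)
next
  case (Suc R)
  interpret S: sigma_finite_subalgebra M "F R" by (rule sigma_finite_subalgebraI[OF subalg])
  let ?N = "time_noise R" and ?m = "\<lambda>\<omega>. mean_T K (pol R \<omega>)"
  have NI: "integrable M (\<lambda>\<omega>. (?N \<omega>)\<^sup>2)" and Nle: "(\<integral>\<omega>. (?N \<omega>)\<^sup>2 \<partial>M) \<le> real R * \<sigma>1"
    using Suc.IH by auto
  have NT: "integrable M (\<lambda>\<omega>. ?N \<omega> * T R \<omega>)" by (rule square_integrable_mult[OF _ _ NI T_sq(1)]) auto
  have mT: "integrable M (\<lambda>\<omega>. ?m \<omega> * T R \<omega>)" by (rule square_integrable_mult[OF _ _ mean_T_sq_int T_sq(1)]) auto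
  have Nm: "integrable M (\<lambda>\<omega>. ?N \<omega> * ?m \<omega>)" by (rule square_integrable_mult[OF _ _ NI mean_T_sq_int]) auto
  have pull: "(\<integral>\<omega>. g \<omega> * T R \<omega> \<partial>M) = (\<integral>\<omega>. g \<omega> * ?m \<omega> \<partial>M)"
    if g: "g \<in> borel_measurable (F R)" and I: "integrable M (\<lambda>\<omega>. g \<omega> * T R \<omega>)" for g
  proof -
    have [measurable]: "g \<in> borel_measurable M" by (rule F_measurable_M[OF g])
    have "(\<integral>\<omega>. g \<omega> * T R \<omega> \<partial>M) = (\<integral>\<omega>. g \<omega> * real_cond_exp M (F R) (T R) \<omega> \<partial>M)"
      using S.real_cond_exp_intg(2)[OF I g] by simp
    also have "\<dots> = (\<integral>\<omega>. g \<omega> * ?m \<omega> \<partial>M)"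
      by (rule integral_cong_AE) (use T_cond_exp[of R] in auto)
    finally show ?thesis .
  qed
  have eq: "(time_noise (Suc R) \<omega>)\<^sup>2 =
      (?N \<omega>)\<^sup>2 + 2 * (?N \<omega> * T R \<omega>) - 2 * (?N \<omega> * ?m \<omega>) + (T R \<omega>)\<^sup>2 - 2 * (?m \<omega> * T R \<omega>) + (?m \<omega>)\<^sup>2" for \<omega>
    by (simp add: time_noise_def power2_eq_square algebra_simps)
  have "integrable M (\<lambda>\<omega>. (time_noise (Suc R) \<omega>)\<^sup>2)"
    unfolding eq using NI NT mT Nm T_sq(1) mean_T_sq_int by simp
  moreover have "(\<integral>\<omega>. (time_noise (Suc R) \<omega>)\<^sup>2 \<partial>M) \<le> real (Suc R) * \<sigma>1"
  proof -
    have "(\<integral>\<omega>. (time_noise (Suc R) \<omega>)\<^sup>2 \<partial>M) = (\<integral>\<omega>. (?N \<omega>)\<^sup>2 \<partial>M) + 2 * (\<integral>\<omega>. ?N \<omega> * T R \<omega> \<partial>M)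
        - 2 * (\<integral>\<omega>. ?N \<omega> * ?m \<omega> \<partial>M) + (\<integral>\<omega>. (T R \<omega>)\<^sup>2 \<partial>M) - 2 * (\<integral>\<omega>. ?m \<omega> * T R \<omega> \<partial>M) + (\<integral>\<omega>. (?m \<omega>)\<^sup>2 \<partial>M)"
      unfolding eq using NI NT mT Nm T_sq(1) mean_T_sq_int by simp
    also have "\<dots> = (\<integral>\<omega>. (?N \<omega>)\<^sup>2 \<partial>M) + (\<integral>\<omega>. (T R \<omega>)\<^sup>2 \<partial>M) - (\<integral>\<omega>. (?m \<omega>)\<^sup>2 \<partial>M)"
      using pull[OF time_noise_measurable NT] pull[OF mean_T_measurable mT] by (simp add: power2_eq_square)
    also have "\<dots> \<le> real R * \<sigma>1 + \<sigma>1"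
    proof -
      have "0 \<le> (\<integral>\<omega>. (?m \<omega>)\<^sup>2 \<partial>M)" by (rule Bochner_Integration.integral_nonneg) simp
      then show ?thesis using Nle T_sq(2)[of R] by linarith
    qed
    finally show ?thesis by (simp add: distrib_right)
  qed
  ultimately show ?case ..
qed

lemma time_noise_squares_negligible:
  "AE \<omega> in M. (\<lambda>k. time_noise (k\<^sup>2) \<omega> / (real k + 1)\<^sup>2) \<longlonglongrightarrow> 0"
proof (rule AE_tendsto_0_of_second_moment[where D = \<sigma>1])
  fix k
  have s1: "0 \<le> \<sigma>1"
    by (rule order.trans[OF Bochner_Integration.integral_nonneg T_sq(2)[of 0]]) simp
  have "real (k\<^sup>2) * \<sigma>1 \<le> (real k + 1)\<^sup>2 * \<sigma>1"
    by (rule mult_right_mono[OF _ s1]) (simp add: power_mono)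
  then show "(\<integral>\<omega>. (time_noise (k\<^sup>2) \<omega>)\<^sup>2 \<partial>M) \<le> \<sigma>1 * (real k + 1)\<^sup>2"
    using time_noise_second_moment[of "k\<^sup>2"] by (simp add: mult.commute)
qed (use time_noise_second_moment in auto)

text \<open>Frames have positive length, so the elapsed time at \<open>R\<close> is at least that at the last square before \<open>R\<close>.\<close>
lemma elapsed_time_lower_bound:
  "AE \<omega> in M. \<forall>R. real ((floor_sqrt R)\<^sup>2) * Tmin + time_noise ((floor_sqrt R)\<^sup>2) \<omega> \<le> (\<Sum>r<R. T r \<omega>)"
proof -
  have "AE \<omega> in M. \<forall>r. 0 < T r \<omega>" by (simp add: AE_all_countable T_pos_AE)
  then show ?thesis using AE_space
  proof eventually_elim
    case (elim \<omega>)
    show ?case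
    proof
      fix R
      let ?n = "(floor_sqrt R)\<^sup>2"
      have "real ?n * Tmin \<le> (\<Sum>r<?n. mean_T K (pol r \<omega>))"
        using sum_bounded_below[of "{..<?n}" Tmin "\<lambda>r. mean_T K (pol r \<omega>)"] T_bounds pol_space[OF elim(2)] by simp
      then have "real ?n * Tmin + time_noise ?n \<omega> \<le> (\<Sum>r<?n. T r \<omega>)"
        by (simp add: time_noise_def sum_subtractf)
      also have "\<dots> \<le> (\<Sum>r<R. T r \<omega>)"
        by (rule sum_mono2) (use elim(1) in \<open>auto intro: less_imp_le order.strict_trans2[OF _ floor_sqrt_power2_le]\<close>)
      finally show "real ?n * Tmin + time_noise ?n \<omega> \<le> (\<Sum>r<R. T r \<omega>)" .
    qed
  qed
qed

end

section \<open>The constraints\<close>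

context queued_renewal
begin

lemma Z_le_Z_plus: 
  assumes l: "l \<in> {1..L}" and \<omega>: "\<omega> \<in> space M" and "s \<le> R"
  shows "Z l R \<omega> \<le> Z l s \<omega> + (\<Sum>r\<in>{s..<R}. \<bar>excess l r \<omega>\<bar>)"
  using \<open>s \<le> R\<close>
proof (induction R rule: dec_induct)
  case (step n)
  have "Z l (Suc n) \<omega> \<le> Z l n \<omega> + \<bar>excess l n \<omega>\<bar>"
    using Z_Suc[OF l \<omega>, of n] Z_nonneg[OF l \<omega>, of n] by linarith
  with step show ?case by simp
qed simp

lemma sum_excess_le_Z:
  assumes l: "l \<in> {1..L}" and \<omega>: "\<omega> \<in> space M"
  shows "(\<Sum>r<R. excess l r \<omega>) \<le> Z l R \<omega>"
proof (induction R)
  case 0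
  show ?case using Z_nonneg[OF l \<omega>] by simp
next
  case (Suc R)
  then show ?case using Z_Suc[OF l \<omega>, of R] by simp
qed

lemma Z_second_moment_le: "l \<in> {1..L} \<Longrightarrow> (\<integral>\<omega>. (Z l r \<omega>)\<^sup>2 \<partial>M) \<le> 2 * (\<integral>\<omega>. lyapunov L Z r \<omega> \<partial>M)"
proof -
  assume l: "l \<in> {1..L}"
  have "(\<integral>\<omega>. (Z l r \<omega>)\<^sup>2 \<partial>M) \<le> (\<integral>\<omega>. 2 * lyapunov L Z r \<omega> \<partial>M)"
  proof (rule integral_mono[OF Z_sq_int[OF l]])
    show "(Z l r \<omega>)\<^sup>2 \<le> 2 * lyapunov L Z r \<omega>" for \<omega>
      using member_le_sum[of l "{1..L}" "\<lambda>l. (Z l r \<omega>)\<^sup>2"] l by (simp add: lyapunov_def)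
  qed (use lyapunov_int in simp)
  then show ?thesis by simp
qed

text \<open>
  An upper bound for the queue valid at all times from \<open>k\<^sup>2\<close> to \<open>(k + 1)\<^sup>2\<close>.
\<close>
definition queue_envelope :: "nat \<Rightarrow> nat \<Rightarrow> 'w \<Rightarrow> real" where
  "queue_envelope l k \<omega> = Z l (k\<^sup>2) \<omega> + (\<Sum>r\<in>{k\<^sup>2..<(Suc k)\<^sup>2}. \<bar>excess l r \<omega>\<bar>)"

text \<open>
  Between the squares lie \<open>2 k + 1\<close> increments. By Cauchy-Schwarz the second moment of the sum of their
  absolute values is at most \<open>(2 k + 1)\<^sup>2\<close> times a constant, the same order \<open>k\<^sup>2\<close> as that of the queue at
  time \<open>k\<^sup>2\<close>.
\<close>
lemma queue_envelope_negligible: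
  assumes l: "l \<in> {1..L}" and D: "\<And>R. (\<integral>\<omega>. lyapunov L Z R \<omega> \<partial>M) \<le> D * (real R + 1)" "0 \<le> D"
  shows "AE \<omega> in M. (\<lambda>k. queue_envelope l k \<omega> / (real k + 1)\<^sup>2) \<longlonglongrightarrow> 0"
proof -
  define e where "e = 2 * \<sigma>1 + 2 * (c l)\<^sup>2 * \<sigma>1"
  have em: "(\<integral>\<omega>. (excess l r \<omega>)\<^sup>2 \<partial>M) \<le> e" for r unfolding e_def by (rule excess_sq(2)[OF l])
  have e0: "0 \<le> e"
    by (rule order.trans[OF Bochner_Integration.integral_nonneg em[of 0]]) simp
  let ?b = "\<lambda>k \<omega>. 2 * (Z l (k\<^sup>2) \<omega>)\<^sup>2 + 2 * (real (2 * k + 1) * (\<Sum>r\<in>{k\<^sup>2..<(Suc k)\<^sup>2}. (excess l r \<omega>)\<^sup>2))"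
  have card: "(Suc k)\<^sup>2 - k\<^sup>2 = 2 * k + 1" for k :: nat by (simp add: power2_eq_square)
  have bI: "integrable M (?b k)" for k
    by (intro Bochner_Integration.integrable_add integrable_mult_right Bochner_Integration.integrable_sum
        Z_sq_int excess_sq(1) l)
  have le: "(queue_envelope l k \<omega>)\<^sup>2 \<le> ?b k \<omega>" for k \<omega>
  proof -
    have "(\<Sum>r\<in>{k\<^sup>2..<(Suc k)\<^sup>2}. \<bar>excess l r \<omega>\<bar>)\<^sup>2 \<le> (\<Sum>r\<in>{k\<^sup>2..<(Suc k)\<^sup>2}. \<bar>excess l r \<omega>\<bar>\<^sup>2) * real (2 * k + 1)"
      using sum_squared_le_sum_of_squares[of "\<lambda>r. \<bar>excess l r \<omega>\<bar>" "{k\<^sup>2..<(Suc k)\<^sup>2}"]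
      by (simp only: card_atLeastLessThan card)
    then show ?thesis
      using power2_add_le[of "Z l (k\<^sup>2) \<omega>" "\<Sum>r\<in>{k\<^sup>2..<(Suc k)\<^sup>2}. \<bar>excess l r \<omega>\<bar>"]
      unfolding queue_envelope_def power2_abs by (simp only: mult.commute[of "real (2 * k + 1)"])
  qed
  have meas: "queue_envelope l k \<in> borel_measurable M" for k
    unfolding queue_envelope_def[abs_def]
    by (intro borel_measurable_add borel_measurable_sum borel_measurable_abs Z_measurable_M excess_measurable_M l)
  have I: "integrable M (\<lambda>\<omega>. (queue_envelope l k \<omega>)\<^sup>2)" for k
    by (rule Bochner_Integration.integrable_bound[OF bI[of k]])
       (use le meas in \<open>auto intro!: AE_I2 order.trans[OF _ abs_ge_self]\<close>)
  show ?thesis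
  proof (rule AE_tendsto_0_of_second_moment[OF meas I, where D = "4 * D + 8 * e"])
    fix k
    have "(\<integral>\<omega>. (queue_envelope l k \<omega>)\<^sup>2 \<partial>M) \<le> (\<integral>\<omega>. ?b k \<omega> \<partial>M)"
      by (rule integral_mono[OF I bI le])
    also have "\<dots> = 2 * (\<integral>\<omega>. (Z l (k\<^sup>2) \<omega>)\<^sup>2 \<partial>M)
        + 2 * (real (2 * k + 1) * (\<Sum>r\<in>{k\<^sup>2..<(Suc k)\<^sup>2}. \<integral>\<omega>. (excess l r \<omega>)\<^sup>2 \<partial>M))"
      using Z_sq_int[OF l] excess_sq(1)[OF l]
      by (subst Bochner_Integration.integral_add) (auto simp: Bochner_Integration.integral_sum)
    also have "\<dots> \<le> 2 * (2 * (D * (real (k\<^sup>2) + 1))) + 2 * (real (2 * k + 1) * (real (2 * k + 1) * e))"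
    proof (intro add_mono mult_left_mono)
      show "(\<integral>\<omega>. (Z l (k\<^sup>2) \<omega>)\<^sup>2 \<partial>M) \<le> 2 * (D * (real (k\<^sup>2) + 1))"
        using Z_second_moment_le[OF l, of "k\<^sup>2"] D(1)[of "k\<^sup>2"] by linarith
      show "(\<Sum>r\<in>{k\<^sup>2..<(Suc k)\<^sup>2}. \<integral>\<omega>. (excess l r \<omega>)\<^sup>2 \<partial>M) \<le> real (2 * k + 1) * e"
        using sum_bounded_above[of "{k\<^sup>2..<(Suc k)\<^sup>2}" "\<lambda>r. \<integral>\<omega>. (excess l r \<omega>)\<^sup>2 \<partial>M" e] em
        by (simp only: card_atLeastLessThan card)
    qed auto
    also have "\<dots> \<le> 4 * (D * (real k + 1)\<^sup>2) + 2 * (4 * (real k + 1)\<^sup>2 * e)"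
    proof (intro add_mono)
      have "real (k\<^sup>2) + 1 \<le> (real k + 1)\<^sup>2" by (simp add: power2_sum)
      from mult_left_mono[OF this D(2)]
      show "2 * (2 * (D * (real (k\<^sup>2) + 1))) \<le> 4 * (D * (real k + 1)\<^sup>2)" by simp
      have "real (2 * k + 1) * real (2 * k + 1) \<le> 4 * (real k + 1)\<^sup>2"
        by (simp add: power2_eq_square algebra_simps)
      from mult_left_mono[OF mult_right_mono[OF this e0], of 2]
      show "2 * (real (2 * k + 1) * (real (2 * k + 1) * e)) \<le> 2 * (4 * (real k + 1)\<^sup>2 * e)"
        by (simp only: mult.assoc zero_le_numeral)
    qed
    also have "\<dots> = (4 * D + 8 * e) * (real k + 1)\<^sup>2" by (simp add: algebra_simps)
    finally show "(\<integral>\<omega>. (queue_envelope l k \<omega>)\<^sup>2 \<partial>M) \<le> (4 * D + 8 * e) * (real k + 1)\<^sup>2" .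
  qed
qed

lemma constraint_almost_surely:
  assumes l: "l \<in> {1..L}" and D: "\<And>R. (\<integral>\<omega>. lyapunov L Z R \<omega> \<partial>M) \<le> D * (real R + 1)" "0 \<le> D"
  shows "AE \<omega> in M. limsup (\<lambda>R. ereal ((\<Sum>r<R. y l r \<omega>) / (\<Sum>r<R. T r \<omega>))) \<le> ereal (c l)"
  using queue_envelope_negligible[OF l D] time_noise_squares_negligible elapsed_time_lower_bound AE_space
proof eventually_elim
  case (elim \<omega>)
  show ?case
  proof (rule limsup_ratio_le_of_squares[OF elim(1,2) Tmin_pos])
    show "0 \<le> queue_envelope l k \<omega>" for k
      unfolding queue_envelope_def using Z_nonneg[OF l elim(4)] by (intro add_nonneg_nonneg sum_nonneg) auto
    show "real ((floor_sqrt R)\<^sup>2) * Tmin + time_noise ((floor_sqrt R)\<^sup>2) \<omega> \<le> (\<Sum>r<R. T r \<omega>)" for R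
      using elim(3) by blast
    fix R
    let ?k = "floor_sqrt R"
    have "(\<Sum>r<R. y l r \<omega>) - c l * (\<Sum>r<R. T r \<omega>) = (\<Sum>r<R. excess l r \<omega>)"
      by (simp add: excess_def sum_subtractf sum_distrib_left)
    also have "\<dots> \<le> Z l R \<omega>" by (rule sum_excess_le_Z[OF l elim(4)])
    also have "\<dots> \<le> Z l (?k\<^sup>2) \<omega> + (\<Sum>r\<in>{?k\<^sup>2..<R}. \<bar>excess l r \<omega>\<bar>)"
      by (rule Z_le_Z_plus[OF l elim(4)]) simp
    also have "\<dots> \<le> queue_envelope l ?k \<omega>"
      unfolding queue_envelope_def
      by (intro add_left_mono sum_mono2) (use Suc_floor_sqrt_power2_gt[of R] in auto)
    finally show "(\<Sum>r<R. y l r \<omega>) - c l * (\<Sum>r<R. T r \<omega>) \<le> queue_envelope l ?k \<omega>" .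
  qed
qed

text \<open>
  The accumulated excess is at most the queue, whose mean is at most the root of its second moment
  and hence of order \<open>\<surd>R\<close>, while the elapsed time has mean at least \<open>R Tmin\<close>.
\<close>
lemma constraint_in_mean:
  assumes l: "l \<in> {1..L}" and D: "\<And>R. (\<integral>\<omega>. lyapunov L Z R \<omega> \<partial>M) \<le> D * (real R + 1)" "0 \<le> D"
  shows "limsup (\<lambda>R. ereal (avg M (y l) R / avg M T R)) \<le> ereal (c l)"
proof -
  let ?g = "\<lambda>R. c l + sqrt (2 * D * (real R + 1)) / (real R * Tmin)"
  have "\<forall>\<^sub>F R in sequentially. ereal (avg M (y l) R / avg M T R) \<le> ereal (?g R)"
    using eventually_gt_at_top[of 0]
  proof eventually_elim
    case (elim R)
    have l0: "l \<in> {0..L}" using l by simp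
    have "(\<Sum>r<R. \<integral>\<omega>. excess l r \<omega> \<partial>M) = (\<integral>\<omega>. (\<Sum>r<R. excess l r \<omega>) \<partial>M)"
      by (rule Bochner_Integration.integral_sum[symmetric]) (rule excess_int[OF l])
    also have "\<dots> \<le> (\<integral>\<omega>. Z l R \<omega> \<partial>M)"
      by (rule integral_mono[OF _ Z_int[OF l] sum_excess_le_Z[OF l]]) (simp_all add: excess_int[OF l])
    also have "\<dots> \<le> sqrt (2 * D * (real R + 1))"
    proof (rule real_le_rsqrt)
      have "(\<integral>\<omega>. Z l R \<omega> \<partial>M)\<^sup>2 \<le> (\<integral>\<omega>. (Z l R \<omega>)\<^sup>2 \<partial>M)"
        using variance_positive[of "Z l R"] variance_eq[OF Z_int[OF l] Z_sq_int[OF l], of R] by linarith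
      also have "\<dots> \<le> 2 * D * (real R + 1)"
        using Z_second_moment_le[OF l, of R] D(1)[of R] by (simp add: mult.assoc)
      finally show "(\<integral>\<omega>. Z l R \<omega> \<partial>M)\<^sup>2 \<le> 2 * D * (real R + 1)" .
    qed
    finally have *: "(\<Sum>r<R. \<integral>\<omega>. excess l r \<omega> \<partial>M) \<le> sqrt (2 * D * (real R + 1))" .
    have "(\<Sum>r<R. \<integral>\<omega>. excess l r \<omega> \<partial>M) = (\<Sum>r<R. \<integral>\<omega>. y l r \<omega> \<partial>M) - c l * (\<Sum>r<R. \<integral>\<omega>. T r \<omega> \<partial>M)"
      using y_int[OF l0] by (simp add: excess_def sum_subtractf sum_distrib_left)
    also have "\<dots> = real R * (avg M (y l) R - c l * avg M T R)"
      using elim by (simp add: avg_def field_simps)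
    finally have 1: "real R * (avg M (y l) R - c l * avg M T R) \<le> sqrt (2 * D * (real R + 1))"
      using * by simp
    note T = avg_T_bounds[OF elim]
    have "avg M (y l) R / avg M T R - c l = real R * (avg M (y l) R - c l * avg M T R) / (real R * avg M T R)"
      using T elim by (simp add: field_simps)
    also have "\<dots> \<le> sqrt (2 * D * (real R + 1)) / (real R * avg M T R)"
      using 1 T elim by (intro divide_right_mono) auto
    also have "\<dots> \<le> sqrt (2 * D * (real R + 1)) / (real R * Tmin)"
      using T elim Tmin_pos D(2) by (intro divide_left_mono mult_left_mono mult_pos_pos) auto
    finally show ?case by simp
  qed
  then have "limsup (\<lambda>R. ereal (avg M (y l) R / avg M T R)) \<le> limsup (\<lambda>R. ereal (?g R))"
    by (rule Limsup_mono)
  also have "\<dots> = ereal (c l)"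
  proof (rule lim_imp_Limsup)
    have "(\<lambda>R. sqrt (real R + 1) / real R) \<longlonglongrightarrow> 0" by real_asymp
    then have "(\<lambda>R. c l + sqrt (2 * D) / Tmin * (sqrt (real R + 1) / real R)) \<longlonglongrightarrow> c l + sqrt (2 * D) / Tmin * 0"
      by (intro tendsto_intros)
    moreover have "?g = (\<lambda>R. c l + sqrt (2 * D) / Tmin * (sqrt (real R + 1) / real R))"
      by (rule ext) (simp only: real_sqrt_mult[of "2 * D"] times_divide_times_eq mult.commute[of Tmin])
    ultimately have "?g \<longlonglongrightarrow> c l" by simp
    then show "(\<lambda>R. ereal (?g R)) \<longlonglongrightarrow> ereal (c l)" by (rule tendsto_ereal)
  qed simp
  finally show ?thesis .
qed

end

section \<open>The objective\<close>

context queued_renewal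
begin

lemma objective_bound:
  assumes B: "drift_bound M L c T y Z B"
    and approx: "additive_approx M P K L T y Z V C" and V: "0 < V"
    and \<rho>: "\<And>z. \<forall>l\<in>{1..L}. 0 \<le> z l \<Longrightarrow>
      (INF p\<in>space P. penalty_ratio V z p) \<le> V * \<rho> + (\<Sum>l=1..L. z l * c l)"
    and R: "0 < R"
  shows "avg M (y 0) R / avg M T R \<le> \<rho> + ((B / avg M T R + C) / V
    + (\<integral>\<omega>. lyapunov L Z 0 \<omega> \<partial>M) / (V * real R * avg M T R))"
proof -
  let ?E = "\<integral>\<omega>. lyapunov L Z 0 \<omega> \<partial>M" and ?a = "avg M T R"
  note a = avg_T_bounds(2)[OF R]
  have nn: "0 \<le> (\<integral>\<omega>. lyapunov L Z R \<omega> \<partial>M)"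
    unfolding lyapunov_def by (auto intro!: integral_nonneg_AE AE_I2 sum_nonneg)
  have "V * (\<Sum>r<R. \<integral>\<omega>. y 0 r \<omega> \<partial>M) \<le> ?E + real R * B + (C + V * \<rho>) * (\<Sum>r<R. \<integral>\<omega>. T r \<omega> \<partial>M)"
    using drift_plus_penalty_telescoped[OF B approx less_imp_le[OF V] \<rho>, of R] nn by simp
  moreover have "(\<Sum>r<R. \<integral>\<omega>. y 0 r \<omega> \<partial>M) = real R * avg M (y 0) R" and "(\<Sum>r<R. \<integral>\<omega>. T r \<omega> \<partial>M) = real R * ?a"
    using R by (simp_all add: avg_def)
  ultimately have "V * (real R * avg M (y 0) R) \<le> ?E + real R * B + (C + V * \<rho>) * (real R * ?a)" by simp
  then have "V * (real R * avg M (y 0) R) / (V * real R * ?a)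
      \<le> (?E + real R * B + (C + V * \<rho>) * (real R * ?a)) / (V * real R * ?a)"
    using V R a by (intro divide_right_mono) auto
  also have "\<dots> = \<rho> + ((B / ?a + C) / V + ?E / (V * real R * ?a))"
    using V R a by (simp add: field_simps)
  finally show ?thesis using V R by simp
qed

text \<open>Needed to replace the average frame length by \<open>Tmin\<close> in a denominator below \<open>B\<close>.\<close>
lemma drift_bound_nonneg:
  assumes B: "drift_bound M L c T y Z B"
  shows "0 \<le> B"
proof -
  interpret S: sigma_finite_subalgebra M "sigma_Z M L Z 0"
    by (rule sigma_finite_subalgebraI[OF sigma_Z_subalgebra])
  let ?f = "\<lambda>l. real_cond_exp M (sigma_Z M L Z 0) (\<lambda>\<omega>. (y l 0 \<omega> - c l * T 0 \<omega>)\<^sup>2)"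
  have "AE \<omega> in M. \<forall>l\<in>{1..L}. 0 \<le> ?f l \<omega>"
    by (rule AE_finite_allI) (auto intro!: S.real_cond_exp_pos)
  moreover have "AE \<omega> in M. (1 / 2) * (\<Sum>l=1..L. ?f l \<omega>) \<le> B" using B by (simp add: drift_bound_def)
  ultimately have "AE \<omega> in M. 0 \<le> B"
  proof eventually_elim
    case (elim \<omega>)
    have "0 \<le> (\<Sum>l=1..L. ?f l \<omega>)" by (rule sum_nonneg) (use elim(1) in blast)
    then show ?case using elim(2) by linarith
  qed
  then show ?thesis by simp
qed

lemma limsup_objective_bound:
  assumes B: "drift_bound M L c T y Z B"
    and approx: "additive_approx M P K L T y Z V C" and V: "0 < V"
    and \<rho>: "\<And>z. \<forall>l\<in>{1..L}. 0 \<le> z l \<Longrightarrow>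
      (INF p\<in>space P. penalty_ratio V z p) \<le> V * \<rho> + (\<Sum>l=1..L. z l * c l)"
  shows "limsup (\<lambda>R. ereal (avg M (y 0) R / avg M T R)) \<le> ereal (\<rho> + (B / Tmin + C) / V)"
proof -
  define E where "E = (\<integral>\<omega>. lyapunov L Z 0 \<omega> \<partial>M)"
  let ?g = "\<lambda>R. \<rho> + (B / Tmin + C) / V + E / (V * Tmin) * (1 / real R)"
  have E0: "0 \<le> E"
    unfolding E_def lyapunov_def by (auto intro!: integral_nonneg_AE AE_I2 sum_nonneg)
  have "\<forall>\<^sub>F R in sequentially. ereal (avg M (y 0) R / avg M T R) \<le> ereal (?g R)"
    using eventually_gt_at_top[of 0]
  proof eventually_elim
    case (elim R)
    note a = avg_T_bounds[OF elim]
    have "avg M (y 0) R / avg M T R \<le> \<rho> + ((B / avg M T R + C) / V + E / (V * real R * avg M T R))"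
      unfolding E_def by (rule objective_bound[OF B approx V \<rho> elim])
    also have "\<dots> \<le> \<rho> + ((B / Tmin + C) / V + E / (V * real R * Tmin))"
      using a Tmin_pos V elim E0 drift_bound_nonneg[OF B]
      by (intro add_left_mono add_mono divide_right_mono add_right_mono divide_left_mono mult_left_mono mult_pos_pos) auto
    finally show ?case by (simp add: mult_ac)
  qed
  then have "limsup (\<lambda>R. ereal (avg M (y 0) R / avg M T R)) \<le> limsup (\<lambda>R. ereal (?g R))"
    by (rule Limsup_mono)
  also have "\<dots> = ereal (\<rho> + (B / Tmin + C) / V)"
  proof (rule lim_imp_Limsup)
    have "?g \<longlonglongrightarrow> \<rho> + (B / Tmin + C) / V + E / (V * Tmin) * 0"
      by (intro tendsto_intros lim_1_over_n)
    then show "(\<lambda>R. ereal (?g R)) \<longlonglongrightarrow> ereal (\<rho> + (B / Tmin + C) / V)" by simp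
  qed simp
  finally show ?thesis .
qed

end

theorem theorem1:
  fixes P :: "'p measure" and K :: "'p \<Rightarrow> outcome measure" and L :: nat
    and y0min y0max Tmin Tmax \<sigma>1 :: real and c :: "nat \<Rightarrow> real"
    and M :: "'w measure" and F :: "nat \<Rightarrow> 'w measure"
    and pol :: "nat \<Rightarrow> 'w \<Rightarrow> 'p" and T :: "nat \<Rightarrow> 'w \<Rightarrow> real"
    and y Z :: "nat \<Rightarrow> nat \<Rightarrow> 'w \<Rightarrow> real" and B C V :: real
  assumes system: "renewal_system P K L y0min y0max Tmin Tmax \<sigma>1"
    and feasible: "feasible P K L c"
    and process: "renewal_process M F P K L pol T y"
    and queues: "virtual_queues M F L c T y Z"
    and B: "drift_bound M L c T y Z B"
    and C: "0 \<le> C" and V: "0 \<le> V"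
    and approx: "additive_approx M P K L T y Z V C"
    and init: "integrable M (lyapunov L Z 0)"
  shows "(\<forall>l\<in>{1..L}.
            limsup (\<lambda>R. ereal (avg M (y l) R / avg M T R)) \<le> ereal (c l) \<and>
            (AE \<omega> in M. limsup (\<lambda>R. ereal ((\<Sum>r<R. y l r \<omega>) / (\<Sum>r<R. T r \<omega>))) \<le> ereal (c l)))
       \<and> (0 < V \<longrightarrow>
            (\<forall>R>0. ereal (avg M (y 0) R / avg M T R)
               \<le> ratio_opt P K L c
                 + ereal ((B / avg M T R + C) / V
                          + (\<integral>\<omega>. lyapunov L Z 0 \<omega> \<partial>M) / (V * real R * avg M T R))) \<and>
            limsup (\<lambda>R. ereal (avg M (y 0) R / avg M T R))
               \<le> ratio_opt P K L c + ereal ((B / Tmin + C) / V))"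
proof -
  interpret queued_renewal P K L y0min y0max Tmin Tmax \<sigma>1 M F pol T y c Z
    by (intro queued_renewal.intro controlled_renewal.intro queued_renewal_axioms.intro system process queues init)
  obtain \<rho> where \<rho>: "ratio_opt P K L c = ereal \<rho>"
    and opt: "\<And>V z. 0 \<le> V \<Longrightarrow> (\<And>l. l \<in> {1..L} \<Longrightarrow> 0 \<le> z l) \<Longrightarrow>
      (INF p\<in>space P. penalty_ratio V z p) \<le> V * \<rho> + (\<Sum>l=1..L. z l * c l)"
    using ratio_opt_finite_and_bounds_penalty_ratio[OF feasible] by blast
  have opt_V: "(INF p\<in>space P. penalty_ratio V z p) \<le> V * \<rho> + (\<Sum>l=1..L. z l * c l)"
    if "\<forall>l\<in>{1..L}. 0 \<le> z l" for z
    using opt[OF V, of z] that by blast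
  obtain D where D: "0 \<le> D" "\<And>R. (\<integral>\<omega>. lyapunov L Z R \<omega> \<partial>M) \<le> D * (real R + 1)"
    using lyapunov_linear_growth[OF B approx V opt_V] by blast
  show ?thesis
    using constraint_in_mean[OF _ D(2,1)] constraint_almost_surely[OF _ D(2,1)]
      objective_bound[OF B approx _ opt_V] limsup_objective_bound[OF B approx _ opt_V]
    by (simp add: \<rho>)
qed

end
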